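(* Consider the time-dependent balls and bins model with feedback exponent $\alpha>1$. Suppose that (S) the sequence $(\sigma_n)_{n\ge1}$ is either bounded or tends to infinity, and (R) the sequence $\rho_n=\sigma_{n+1}/\tau_n$, $n\ge 0$, is either bounded or tends to infinity. Then $\mathbb{P}(\mathcal{D})=1$, where $\mathcal{D}=\{\lim_{n\to\infty}\Theta_n\text{ exists and belongs to }\{0,1\}\}$.
   Context: The time-dependent balls and bins model with two bins: let $(\sigma_n)_{n\ge 1}$ be a sequence of positive integers, let $\tau_0$ and $T_0$ be integers with $0<T_0<\tau_0$, and let $\tau_n=\tau_0+\sum_{i=1}^n\sigma_i$. With feedback exponent $\alpha$, define for $n\ge 0$: $\Theta_n=T_n/\tau_n$, $P_n=\frac{\Theta_n^{\alpha}}{\Theta_n^{\alpha}+(1-\Theta_n)^{\alpha}}$, and $T_{n+1}=T_n+B_{n+1}$, where conditionally on $\mathcal{F}_n=\sigma(B_1,\dots,B_n)$ the random variable $B_{n+1}$ is Binomial with size $\sigma_{n+1}$ (number of trials) and success probability $P_n$. Thus $T_n$ is the number of balls in the first bin at time $n$ out of $\tau_n$ balls in total. The event $\mathcal{D}$ is called dominance. *)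

theory Defs
  imports "HOL-Probability.Probability"
begin

text \<open>
  The step sizes are a sequence \<open>\<sigma>\<close> used at indices \<open>n \<ge> 1\<close> only, and likewise
  \<open>B n\<close> is the number of balls added to the first bin at step \<open>n \<ge> 1\<close>;
  the values \<open>\<sigma> 0\<close> and \<open>B 0\<close> play no role.
\<close>

definition total_balls :: "(nat \<Rightarrow> nat) \<Rightarrow> nat \<Rightarrow> nat \<Rightarrow> nat" where
  "total_balls \<sigma> \<tau>0 n = \<tau>0 + (\<Sum>i=1..n. \<sigma> i)"

definition growth_ratio :: "(nat \<Rightarrow> nat) \<Rightarrow> nat \<Rightarrow> nat \<Rightarrow> real" where
  "growth_ratio \<sigma> \<tau>0 n = real (\<sigma> (Suc n)) / real (total_balls \<sigma> \<tau>0 n)"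

definition first_bin :: "nat \<Rightarrow> (nat \<Rightarrow> 'a \<Rightarrow> nat) \<Rightarrow> nat \<Rightarrow> 'a \<Rightarrow> nat" where
  "first_bin T0 B n \<omega> = T0 + (\<Sum>i=1..n. B i \<omega>)"

definition proportion ::
    "(nat \<Rightarrow> nat) \<Rightarrow> nat \<Rightarrow> nat \<Rightarrow> (nat \<Rightarrow> 'a \<Rightarrow> nat) \<Rightarrow> nat \<Rightarrow> 'a \<Rightarrow> real" where
  "proportion \<sigma> \<tau>0 T0 B n \<omega> = real (first_bin T0 B n \<omega>) / real (total_balls \<sigma> \<tau>0 n)"

definition feedback :: "real \<Rightarrow> real \<Rightarrow> real" where
  "feedback \<alpha> \<theta> = \<theta> powr \<alpha> / (\<theta> powr \<alpha> + (1 - \<theta>) powr \<alpha>)"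

definition history :: "'a measure \<Rightarrow> (nat \<Rightarrow> 'a \<Rightarrow> nat) \<Rightarrow> nat \<Rightarrow> 'a measure" where
  "history M B n = sigma (space M) {B i -` A \<inter> space M | i A. i \<in> {1..n}}"

text \<open>
  The conditional law of \<open>B (Suc n)\<close> is required almost surely only. Almost surely
  \<open>B i \<le> \<sigma> i\<close> for all \<open>i \<ge> 1\<close>, so the proportion lies strictly between 0 and 1, and the values of
  \<open>powr\<close> and \<open>binomial_pmf\<close> outside their intended domains are irrelevant.
\<close>

locale balls_and_bins = prob_space M
  for M :: "'a measure" +
  fixes \<alpha> :: real
    and \<sigma> :: "nat \<Rightarrow> nat"
    and \<tau>0 T0 :: nat
    and B :: "nat \<Rightarrow> 'a \<Rightarrow> nat"
  assumes step_size_pos: "\<And>n. n \<ge> 1 \<Longrightarrow> \<sigma> n > 0"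
    and initial: "0 < T0" "T0 < \<tau>0"
    and random_variable_B: "\<And>n. n \<ge> 1 \<Longrightarrow> B n \<in> M \<rightarrow>\<^sub>M count_space UNIV"
    and conditional_law: "\<And>n A. AE \<omega> in M.
          real_cond_exp M (history M B n) (indicator (B (Suc n) -` A \<inter> space M)) \<omega>
          = measure_pmf.prob
              (binomial_pmf (\<sigma> (Suc n)) (feedback \<alpha> (proportion \<sigma> \<tau>0 T0 B n \<omega>))) A"

definition dominance ::
    "'a measure \<Rightarrow> (nat \<Rightarrow> nat) \<Rightarrow> nat \<Rightarrow> nat \<Rightarrow> (nat \<Rightarrow> 'a \<Rightarrow> nat) \<Rightarrow> 'a set" where
  "dominance M \<sigma> \<tau>0 T0 B =
     {\<omega> \<in> space M. \<exists>L\<in>{0, 1}. (\<lambda>n. proportion \<sigma> \<tau>0 T0 B n \<omega>) \<longlonglongrightarrow> L}"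

end

theory Submission
  imports Defs
begin

text \<open>Let \<open>s k = \<sigma> (k + 1) / \<tau> (k + 1)\<^sup>2\<close>, which bounds the conditional variance of step \<open>k\<close> up to the factor
  1/4. Since \<open>s k \<le> 1 / \<tau> k - 1 / \<tau> (k + 1)\<close>, the martingale part of \<open>\<Theta>\<close> converges almost surely. The drift
  points away from 1/2 and its weights \<open>\<sigma> (k + 1) / \<tau> (k + 1)\<close> have infinite sum, so \<open>\<Theta>\<close> converges to 0, 1/2 or 1.

  To exclude the limit 1/2, put \<open>V = (\<Sum>k\<ge>n. s k)\<close>. By Chebyshev, a process at distance \<open>sqrt V\<close> from 1/2
  fails to return to 1/2 with probability bounded below, and it reaches that distance because near 1/2
  its variance is comparable to \<open>V\<close> while the fourth moment of the noise is \<open>O(V\<^sup>2)\<close>, because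
  \<open>1 / \<tau> (k + 1)\<^sup>2 \<le> s k\<close>. One bounded supermartingale combines the two
  steps. Hence the conditional probability of the limit 1/2 stays below a constant \<open>q < 1\<close> at all large
  times, and the limit 1/2 has probability 0.\<close>

section \<open>The deterministic dynamics\<close>

text \<open>A single step may add as many balls as are present already, or more. It can throw the
  process from near 1/2 far away, and its drift can move the conditional mean almost to
  \<open>feedback \<alpha> \<theta>\<close>. Increments are therefore not small perturbations of a
  smooth flow: estimates are made step by step with binomial moments, and the drift near 1/2 is
  controlled only through a slope bound \<open>L\<close> for \<open>feedback\<close> at 1/2.

  The scale sqrt V is natural because after the reference time the martingale part has variance at
  most V / 4. With x the distance from 1/2, escape is measured by 1 - z + z^2, where z = \<kappa>
  x^2 / V. The choice \<kappa> = 1 / (64 L^2) keeps z small wherever the drift of one step can lead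
  from |x| \<le> sqrt V. A term \<kappa> w / (8 V), with w the noise still to come, is subtracted.
  It vanishes in the long run, so the function tends to 1 along paths tending to 1/2, while at the
  reference time w = V puts it at least \<kappa> / 8 below 1 within distance sqrt V. This gap makes
  q < 1.\<close>

lemma feedback_nonneg: "0 \<le> feedback \<alpha> \<theta>"
  by (simp add: feedback_def)

lemma feedback_le_1: "feedback \<alpha> \<theta> \<le> 1"
  unfolding feedback_def by (cases "\<theta> powr \<alpha> + (1 - \<theta>) powr \<alpha> = 0") (auto simp: divide_le_eq_1 order_less_le)

lemma feedback_denom_pos:
  assumes "0 \<le> \<theta>" "\<theta> \<le> (1::real)"
  shows "0 < \<theta> powr \<alpha> + (1 - \<theta>) powr \<alpha>"
proof (cases "\<theta> = 0")
  case False
  with assms have "0 < \<theta> powr \<alpha>" by simp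
  then show ?thesis by (simp add: add_pos_nonneg)
qed simp

lemma feedback_reflect:
  assumes "0 \<le> \<theta>" "\<theta> \<le> 1"
  shows "feedback \<alpha> (1 - \<theta>) = 1 - feedback \<alpha> \<theta>"
  using feedback_denom_pos[OF assms, of \<alpha>] by (simp add: feedback_def field_simps)

lemma feedback_half: "feedback \<alpha> (1 / 2) = 1 / 2"
  by (simp add: feedback_def)

text \<open>Clearing denominators leaves \<open>\<theta> * (1 - \<theta>) powr \<alpha> < (1 -
  \<theta>) * \<theta> powr \<alpha>\<close>. This is \<theta> (1 - \<theta>) times the strict
  monotonicity of t^(\<alpha> - 1), applied to 1 - \<theta> < \<theta>; here \<alpha> > 1
  enters.\<close>

lemma feedback_gt:
  assumes "1 < \<alpha>" "1 / 2 < \<theta>" "\<theta> < 1"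
  shows "\<theta> < feedback \<alpha> \<theta>"
proof -
  have "(1 - \<theta>) powr (\<alpha> - 1) < \<theta> powr (\<alpha> - 1)"
    using assms by (intro powr_less_mono2) auto
  then have "\<theta> * (1 - \<theta>) * (1 - \<theta>) powr (\<alpha> - 1) < \<theta> * (1 - \<theta>) * \<theta> powr (\<alpha> - 1)"
    using assms by (intro mult_strict_left_mono) auto
  moreover have "t powr \<alpha> = t * t powr (\<alpha> - 1)" if "0 < t" for t :: real
    using that powr_add[of t 1 "\<alpha> - 1"] by simp
  ultimately have "\<theta> * (1 - \<theta>) powr \<alpha> < (1 - \<theta>) * \<theta> powr \<alpha>"
    using assms by (simp add: mult_ac)
  then show ?thesis
    using feedback_denom_pos[of \<theta> \<alpha>] assms by (simp add: feedback_def field_simps)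
qed

lemma feedback_ge:
  assumes "1 < \<alpha>" "1 / 2 \<le> \<theta>" "\<theta> \<le> 1"
  shows "\<theta> \<le> feedback \<alpha> \<theta>"
proof -
  consider "\<theta> = 1 / 2" | "\<theta> = 1" | "1 / 2 < \<theta>" "\<theta> < 1" using assms by linarith
  then show ?thesis
  proof cases
    case 3
    then show ?thesis using feedback_gt[OF assms(1)] by (simp add: less_imp_le)
  next
    case 1
    then show ?thesis using feedback_half[of \<alpha>] by (simp only:)
  next
    case 2
    then show ?thesis by (simp add: feedback_def)
  qed
qed

lemma continuous_on_feedback:
  assumes "0 < \<alpha>"
  shows "continuous_on {0..1} (feedback \<alpha>)"
  unfolding feedback_def
  by (intro continuous_intros continuous_on_powr')
    (use assms feedback_denom_pos in \<open>auto simp: less_imp_neq[symmetric]\<close>)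

text \<open>The difference quotient at 1/2 has a limit \<open>D\<close>, so it is bounded nearby.
  The constant \<open>\<bar>D\<bar> + 1\<close> also supplies \<open>1 \<le> L\<close>, so that one
  constant serves both \<open>\<theta>\<close> and \<open>feedback \<alpha> \<theta>\<close> in the
  average of the two that a step forms.\<close>

lemma feedback_lipschitz_at_half:
  obtains L \<delta> :: real where "1 \<le> L" "0 < \<delta>"
    "\<And>\<theta>. \<bar>\<theta> - 1 / 2\<bar> < \<delta> \<Longrightarrow> \<bar>feedback \<alpha> \<theta> - 1 / 2\<bar> \<le> L * \<bar>\<theta> - 1 / 2\<bar>"
proof -
  have "\<exists>D. (feedback \<alpha> has_real_derivative D) (at (1 / 2))"
    unfolding feedback_def[abs_def]
    by (rule exI) (auto intro!: derivative_eq_intros simp: add_pos_pos)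
  then obtain D where "(feedback \<alpha> has_real_derivative D) (at (1 / 2))" ..
  then have "(\<lambda>\<theta>. (feedback \<alpha> \<theta> - 1 / 2) / (\<theta> - 1 / 2)) \<midarrow>1 / 2\<rightarrow> D"
    by (simp add: has_field_derivative_iff feedback_half)
  then have "((\<lambda>\<theta>. \<bar>(feedback \<alpha> \<theta> - 1 / 2) / (\<theta> - 1 / 2)\<bar>) \<longlongrightarrow> \<bar>D\<bar>) (at (1 / 2))"
    by (rule tendsto_rabs)
  then have "eventually (\<lambda>\<theta>. \<bar>(feedback \<alpha> \<theta> - 1 / 2) / (\<theta> - 1 / 2)\<bar> < \<bar>D\<bar> + 1) (at (1 / 2))"
    by (rule order_tendstoD) simp
  then obtain \<delta> where \<delta>: "0 < \<delta>" and bd: "\<And>\<theta>. \<theta> \<noteq> 1 / 2 \<Longrightarrow> \<bar>\<theta> - 1 / 2\<bar> < \<delta> \<Longrightarrow>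
      \<bar>(feedback \<alpha> \<theta> - 1 / 2) / (\<theta> - 1 / 2)\<bar> < \<bar>D\<bar> + 1"
    by (auto simp: eventually_at dist_real_def)
  have "\<bar>feedback \<alpha> \<theta> - 1 / 2\<bar> \<le> (\<bar>D\<bar> + 1) * \<bar>\<theta> - 1 / 2\<bar>" if "\<bar>\<theta> - 1 / 2\<bar> < \<delta>" for \<theta>
  proof (cases "\<theta> = 1 / 2")
    case False
    then show ?thesis using bd[OF False that] by (simp add: abs_divide divide_less_eq less_imp_le split: if_splits)
  next
    case True
    then show ?thesis using feedback_half[of \<alpha>] by (simp only:) simp
  qed
  then show thesis using that[of "\<bar>D\<bar> + 1" \<delta>] \<delta> by simp
qed

text \<open>Once \<open>m\<close> oscillates by less than \<open>\<delta> / 2\<close>, a visit above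
  \<open>1 / 2 + \<delta>\<close> traps the path above \<open>1 / 2 + \<delta> / 2\<close>, where
  all drift terms are nonnegative. Their sum is bounded because \<open>x\<close> is, so
  \<open>x\<close> converges. A limit \<open>l < 1\<close> would eventually keep the drift terms
  above a positive multiple of \<open>\<gamma>\<close>, which is not summable.\<close>

lemma drift_tendsto_one:
  fixes f :: "real \<Rightarrow> real" and x m \<gamma> :: "nat \<Rightarrow> real"
  assumes x: "\<And>n. x n \<in> {0..1}"
    and step: "\<And>n. x (Suc n) = x n + \<gamma> n * (f (x n) - x n) + (m (Suc n) - m n)"
    and m: "convergent m"
    and \<gamma>: "\<And>n. 0 \<le> \<gamma> n" "\<not> summable \<gamma>"
    and f: "continuous_on {0..1} f" "\<And>t. 1 / 2 \<le> t \<Longrightarrow> t \<le> 1 \<Longrightarrow> t \<le> f t"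
      "\<And>t. 1 / 2 < t \<Longrightarrow> t < 1 \<Longrightarrow> t < f t"
    and \<delta>: "0 < \<delta>" "\<exists>\<^sub>F n in sequentially. 1 / 2 + \<delta> \<le> x n"
  shows "x \<longlonglongrightarrow> 1"
proof -
  have "Cauchy m" using m by (simp add: Cauchy_convergent_iff)
  then obtain N where N: "\<And>k l. k \<ge> N \<Longrightarrow> l \<ge> N \<Longrightarrow> \<bar>m k - m l\<bar> < \<delta> / 2"
    using \<delta>(1) by (metis CauchyD half_gt_zero real_norm_def)
  from \<delta>(2) obtain n where n: "n \<ge> N" "1 / 2 + \<delta> \<le> x n"
    by (auto simp: frequently_sequentially)
  define S where "S k = (\<Sum>j<k. \<gamma> (n + j) * (f (x (n + j)) - x (n + j)))" for k
  have x_eq: "x (n + k) = x n + (m (n + k) - m n) + S k" for k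
    by (induction k) (simp_all add: S_def step)
  \<comment> \<open>The induction is strong because \<open>S k\<close> collects the drifts at all
    earlier positions, each nonnegative since that position lies above 1/2.\<close>
  have low: "1 / 2 + \<delta> / 2 \<le> x (n + k)" for k
  proof (induction k rule: less_induct)
    case (less k)
    have "0 \<le> S k" unfolding S_def
    proof (intro sum_nonneg mult_nonneg_nonneg)
      fix j assume "j \<in> {..<k}"
      then have "x (n + j) \<le> f (x (n + j))" using less[of j] x[of "n + j"] \<delta>(1) by (intro f(2)) auto
      then show "0 \<le> f (x (n + j)) - x (n + j)" by simp
    qed (rule \<gamma>)
    moreover have "\<bar>m (n + k) - m n\<bar> < \<delta> / 2" using N n(1) by simp
    ultimately show ?case using x_eq[of k] n(2) by linarith
  qed
  have drift_nonneg: "0 \<le> \<gamma> (n + j) * (f (x (n + j)) - x (n + j))" for j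
    using low[of j] x[of "n + j"] \<delta>(1) f(2)[of "x (n + j)"] \<gamma>(1)[of "n + j"] by simp
  have S_le: "S k \<le> 1 + \<delta> / 2" for k
  proof -
    have "\<bar>m n - m (n + k)\<bar> < \<delta> / 2" using N n(1) by simp
    moreover have "x (n + k) \<le> 1" "0 \<le> x n" using x[of "n + k"] x[of n] by auto
    ultimately show ?thesis using x_eq[of k] by linarith
  qed
  have "(\<Sum>j\<le>k. \<gamma> (n + j) * (f (x (n + j)) - x (n + j))) \<le> 1 + \<delta> / 2" for k
    using S_le[of "Suc k"] by (simp only: S_def lessThan_Suc_atMost)
  then have smb: "summable (\<lambda>j. \<gamma> (n + j) * (f (x (n + j)) - x (n + j)))"
    by (rule bounded_imp_summable[OF drift_nonneg])
  have "convergent S"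
    using summable_LIMSEQ[OF smb] unfolding S_def convergent_def by blast
  moreover have "convergent (\<lambda>k. m (n + k))"
    using m convergent_ignore_initial_segment[of m n] by (simp add: add.commute)
  ultimately have "convergent (\<lambda>k. x n + (m (n + k) - m n) + S k)"
    by (intro convergent_add convergent_diff convergent_const)
  then obtain l where l: "(\<lambda>k. x (n + k)) \<longlonglongrightarrow> l"
    unfolding x_eq[symmetric] convergent_def by blast
  then have xl: "x \<longlonglongrightarrow> l"
    using LIMSEQ_ignore_initial_segment LIMSEQ_offset[of x n l] by (simp add: add.commute)
  have l1: "l \<le> 1" using l x by (intro LIMSEQ_le_const2[OF l]) auto
  have l2: "1 / 2 + \<delta> / 2 \<le> l" using low by (intro LIMSEQ_le_const[OF l]) auto
  have "l = 1"
  proof (rule ccontr)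
    assume "l \<noteq> 1"
    then have gap: "0 < f l - l" using f(3)[of l] l1 l2 \<delta>(1) by simp
    have "(\<lambda>k. f (x (n + k))) \<longlonglongrightarrow> f l"
      using l1 l2 \<delta>(1) x by (intro continuous_on_tendsto_compose[OF f(1) l]) auto
    then have "(\<lambda>k. f (x (n + k)) - x (n + k)) \<longlonglongrightarrow> f l - l"
      by (intro tendsto_diff l)
    then have "eventually (\<lambda>k. (f l - l) / 2 < f (x (n + k)) - x (n + k)) sequentially"
      using gap by (intro order_tendstoD(1)) auto
    then have "eventually (\<lambda>k. norm (\<gamma> (n + k)) \<le>
        2 / (f l - l) * (\<gamma> (n + k) * (f (x (n + k)) - x (n + k)))) sequentially"
    proof eventually_elim
      case (elim k)
      then have "\<gamma> (n + k) * ((f l - l) / 2) \<le> \<gamma> (n + k) * (f (x (n + k)) - x (n + k))"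
        using \<gamma>(1) by (intro mult_left_mono) auto
      then show ?case using gap \<gamma>(1)[of "n + k"] by (simp add: field_simps)
    qed
    then have "summable (\<lambda>k. \<gamma> (n + k))"
      by (rule summable_comparison_test_ev[OF _ summable_mult[OF smb]])
    then show False using \<gamma>(2) summable_iff_shift[of \<gamma> n] by (simp add: add.commute)
  qed
  with xl show ?thesis by simp
qed

text \<open>A path that does not tend to 1/2 is infinitely often a distance \<open>\<delta>\<close>
  away, hence infinitely often so on one fixed side. The lower side becomes the upper one for
  \<open>1 - x\<close> with noise \<open>- m\<close>, since \<open>feedback\<close> commutes with
  the reflection.\<close>

lemma feedback_drift_limits:
  fixes x m \<gamma> :: "nat \<Rightarrow> real"
  assumes "1 < \<alpha>"
    and x: "\<And>n. x n \<in> {0..1}"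
    and step: "\<And>n. x (Suc n) = x n + \<gamma> n * (feedback \<alpha> (x n) - x n) + (m (Suc n) - m n)"
    and m: "convergent m"
    and \<gamma>: "\<And>n. 0 \<le> \<gamma> n" "\<not> summable \<gamma>"
  shows "x \<longlonglongrightarrow> 0 \<or> x \<longlonglongrightarrow> 1 / 2 \<or> x \<longlonglongrightarrow> 1"
proof (cases "x \<longlonglongrightarrow> 1 / 2")
  case False
  note cont = continuous_on_feedback[of \<alpha>]
  from False obtain \<delta> where \<delta>: "0 < \<delta>" and fr: "\<exists>\<^sub>F n in sequentially. \<delta> \<le> \<bar>x n - 1 / 2\<bar>"
    unfolding tendsto_iff frequently_def by (auto simp: dist_real_def not_le)
  from fr have "\<exists>\<^sub>F n in sequentially. 1 / 2 + \<delta> \<le> x n \<or> 1 / 2 + \<delta> \<le> 1 - x n"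
    by (rule frequently_elim1) auto
  then have "(\<exists>\<^sub>F n in sequentially. 1 / 2 + \<delta> \<le> x n) \<or> (\<exists>\<^sub>F n in sequentially. 1 / 2 + \<delta> \<le> 1 - x n)"
    by (simp only: frequently_disj_iff)
  then show ?thesis
  proof
    assume "\<exists>\<^sub>F n in sequentially. 1 / 2 + \<delta> \<le> x n"
    then have "x \<longlonglongrightarrow> 1"
      using \<open>1 < \<alpha>\<close> feedback_ge feedback_gt \<delta>
      by (intro drift_tendsto_one[OF x step m \<gamma> cont]) auto
    then show ?thesis by simp
  next
    assume fr: "\<exists>\<^sub>F n in sequentially. 1 / 2 + \<delta> \<le> 1 - x n"
    have "(\<lambda>n. 1 - x n) \<longlonglongrightarrow> 1"
    proof (rule drift_tendsto_one[where f="feedback \<alpha>" and m="\<lambda>n. - m n" and \<gamma>=\<gamma>, OF _ _ _ \<gamma> cont])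
      show "1 - x (Suc n) = 1 - x n + \<gamma> n * (feedback \<alpha> (1 - x n) - (1 - x n)) + (- m (Suc n) - - m n)" for n
        using x[of n] by (simp add: feedback_reflect step algebra_simps)
    qed (use \<open>1 < \<alpha>\<close> feedback_ge feedback_gt \<delta> m x fr convergent_minus_iff[of m] in auto)
    then have "x \<longlonglongrightarrow> 0"
      using tendsto_diff[OF tendsto_const[of 1], of "\<lambda>n. 1 - x n" 1] by simp
    then show ?thesis by simp
  qed
qed simp

section \<open>Binomial moments\<close>

lemma integrable_binomial_pmf:
  fixes h :: "nat \<Rightarrow> real"
  assumes "0 \<le> p" "p \<le> 1"
  shows "integrable (measure_pmf (binomial_pmf n p)) h"
  using assms by (intro integrable_measure_pmf_finite) (simp add: set_pmf_binomial_eq)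

lemma expectation_binomial_Suc:
  fixes h :: "nat \<Rightarrow> real"
  assumes "0 \<le> p" "p \<le> 1"
  shows "measure_pmf.expectation (binomial_pmf (Suc n) p) h =
    measure_pmf.expectation (binomial_pmf n p) (\<lambda>k. p * h (Suc k) + (1 - p) * h k)"
proof -
  have fin: "finite (set_pmf (binomial_pmf n p))" using assms by (simp add: set_pmf_binomial_eq)
  have "measure_pmf.expectation (binomial_pmf (Suc n) p) h =
    (\<Sum>b\<in>UNIV. pmf (bernoulli_pmf p) b *\<^sub>R
      measure_pmf.expectation (map_pmf (\<lambda>k. (if b then 1 else 0) + k) (binomial_pmf n p)) h)"
    using assms fin unfolding map_pmf_def
    by (subst binomial_pmf_Suc, simp, intro pmf_expectation_bind) auto
  also have "\<dots> = measure_pmf.expectation (binomial_pmf n p) (\<lambda>k. p * h (Suc k) + (1 - p) * h k)"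
    using assms by (simp add: UNIV_bool Bochner_Integration.integral_add integrable_binomial_pmf)
  finally show ?thesis .
qed

definition binomial_moment :: "nat \<Rightarrow> nat \<Rightarrow> real \<Rightarrow> real" where
  "binomial_moment r n p = measure_pmf.expectation (binomial_pmf n p) (\<lambda>k. (real k - real n * p) ^ r)"

lemma binomial_moment_1:
  assumes "0 \<le> p" "p \<le> 1"
  shows "binomial_moment 1 n p = 0"
proof (induction n)
  case (Suc n)
  have "binomial_moment 1 (Suc n) p = binomial_moment 1 n p"
    unfolding binomial_moment_def expectation_binomial_Suc[OF assms]
    by (intro Bochner_Integration.integral_cong) (auto simp: algebra_simps)
  then show ?case using Suc by simp
qed (use assms in \<open>simp add: binomial_moment_def binomial_pmf_0\<close>)

lemma binomial_moment_2:
  assumes "0 \<le> p" "p \<le> 1"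
  shows "binomial_moment 2 n p = n * (p * (1 - p))"
proof (induction n)
  case (Suc n)
  have "binomial_moment 2 (Suc n) p = measure_pmf.expectation (binomial_pmf n p)
      (\<lambda>k. (real k - real n * p) ^ 2 + p * (1 - p))"
    unfolding binomial_moment_def expectation_binomial_Suc[OF assms]
    by (intro Bochner_Integration.integral_cong) (auto simp: algebra_simps power2_eq_square)
  also have "\<dots> = binomial_moment 2 n p + p * (1 - p)"
    unfolding binomial_moment_def
    by (subst Bochner_Integration.integral_add) (auto intro: integrable_binomial_pmf[OF assms])
  finally show ?case using Suc by (simp add: algebra_simps)
qed (use assms in \<open>simp add: binomial_moment_def binomial_pmf_0\<close>)

text \<open>The absence of a cubic term spares the third central moment. Potentials are brought to,
  or bounded by, this shape before they are integrated.\<close>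

lemma expectation_binomial_quartic:
  assumes "0 \<le> p" "p \<le> 1"
  shows "measure_pmf.expectation (binomial_pmf n p)
      (\<lambda>k. a + b * (real k - real n * p) + c * (real k - real n * p) ^ 2 + d * (real k - real n * p) ^ 4)
    = a + c * (n * (p * (1 - p))) + d * binomial_moment 4 n p"
proof -
  note I = integrable_binomial_pmf[OF assms]
  have "measure_pmf.expectation (binomial_pmf n p) (\<lambda>k. real k - real n * p) = 0"
    using binomial_moment_1[OF assms] by (simp add: binomial_moment_def)
  then show ?thesis
    using binomial_moment_2[OF assms, of n] by (simp add: I binomial_moment_def)
qed

lemma mult_one_minus_le: "p * (1 - p) \<le> 1 / 4" for p :: real
  using zero_le_power2[of "p - 1 / 2"] by (simp add: power2_eq_square algebra_simps)

text \<open>With \<open>v = p * (1 - p)\<close>, one more trial adds v (1 - 3 v) plus 6 v times the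
  second moment n v: the cubic terms cancel and the linear one has mean zero. The bound v \<le> 1/4
  then makes the recursion solvable.\<close>

lemma binomial_moment_4_le:
  assumes "0 \<le> p" "p \<le> 1"
  shows "binomial_moment 4 n p \<le> n / 4 + 3 * n ^ 2 / 16"
proof (induction n)
  case (Suc n)
  define v where "v = p * (1 - p)"
  have v: "0 \<le> v" "v \<le> 1 / 4" using assms mult_one_minus_le[of p] by (auto simp: v_def)
  have "binomial_moment 4 (Suc n) p = measure_pmf.expectation (binomial_pmf n p)
      (\<lambda>k. v * (1 - 3 * v) + 4 * v * (1 - 2 * p) * (real k - real n * p)
        + 6 * v * (real k - real n * p) ^ 2 + 1 * (real k - real n * p) ^ 4)"
    unfolding binomial_moment_def expectation_binomial_Suc[OF assms]
  proof (intro Bochner_Integration.integral_cong refl)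
    fix k
    define X where "X = real k - real n * p"
    have "real (Suc k) - real (Suc n) * p = X + (1 - p)" "real k - real (Suc n) * p = X - p"
      by (simp_all add: X_def algebra_simps)
    then show "p * (real (Suc k) - real (Suc n) * p) ^ 4 + (1 - p) * (real k - real (Suc n) * p) ^ 4 =
        v * (1 - 3 * v) + 4 * v * (1 - 2 * p) * (real k - real n * p)
        + 6 * v * (real k - real n * p) ^ 2 + 1 * (real k - real n * p) ^ 4"
      unfolding X_def[symmetric] v_def by (simp add: eval_nat_numeral algebra_simps)
  qed
  also have "\<dots> = v * (1 - 3 * v) + 6 * v * (n * v) + binomial_moment 4 n p"
    by (subst expectation_binomial_quartic[OF assms]) (simp add: v_def)
  also have "v * (1 - 3 * v) \<le> 1 / 4" using v mult_nonneg_nonneg[of v v] unfolding right_diff_distrib by linarith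
  also have "6 * v * (n * v) \<le> 6 * (1 / 4) * (n * (1 / 4))" using v by (intro mult_mono) auto
  finally show ?case using Suc by (simp add: power2_eq_square field_simps)
qed (use assms in \<open>simp add: binomial_moment_def binomial_pmf_0\<close>)

text \<open>The hypotheses on \<open>x\<close> and \<open>y\<close> say that the drift does not lead
  towards 0. With a common sign \<open>e\<close> of both, \<open>\<bar>y + z\<bar>\<close> is at
  least \<open>\<bar>x\<bar> + e * z\<close>, so a quadratic polynomial in the noise dominates the
  squared positive part. Its linear term has mean zero, and its quadratic term yields the
  variance.\<close>

lemma expectation_hitting_potential_le:
  assumes p: "0 \<le> p" "p \<le> 1" and xy: "\<bar>x\<bar> \<le> \<bar>y\<bar>" "0 \<le> x * y"
  shows "measure_pmf.expectation (binomial_pmf n p) (\<lambda>k. (max 0 (b - \<bar>y + (real k - real n * p) / t\<bar>)) ^ 2)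
    \<le> (max 0 (b - \<bar>x\<bar>)) ^ 2 + p * (1 - p) * (n / t ^ 2)"
proof -
  define r where "r = b - \<bar>x\<bar>"
  have sq: "(max 0 w) ^ 2 \<le> (max 0 r) ^ 2 - 2 * max 0 r * z + z ^ 2" if "w \<le> r - z" for w z
  proof -
    have "(max 0 w) ^ 2 \<le> (max 0 (r - z)) ^ 2" using that by (intro power_mono) auto
    also have "\<dots> \<le> (max 0 r) ^ 2 - 2 * max 0 r * z + z ^ 2"
      using zero_le_power2[of "r - z"] by (auto simp: max_def power2_eq_square algebra_simps)
    finally show ?thesis .
  qed
  obtain e :: real where e: "e = 1 \<or> e = - 1" "e * x = \<bar>x\<bar>" "e * y = \<bar>y\<bar>"
  proof (cases "0 < x \<or> x = 0 \<and> 0 \<le> y")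
    case True
    then show thesis using xy that[of 1] by (auto simp: zero_le_mult_iff)
  next
    case False
    then show thesis using xy that[of "- 1"] by (auto simp: zero_le_mult_iff)
  qed
  have "measure_pmf.expectation (binomial_pmf n p) (\<lambda>k. (max 0 (b - \<bar>y + (real k - real n * p) / t\<bar>)) ^ 2)
    \<le> measure_pmf.expectation (binomial_pmf n p) (\<lambda>k. (max 0 r) ^ 2 + (- 2 * max 0 r * e / t) * (real k - real n * p)
       + (1 / t ^ 2) * (real k - real n * p) ^ 2 + 0 * (real k - real n * p) ^ 4)"
  proof (intro integral_mono integrable_binomial_pmf p)
    fix k
    define z where "z = (real k - real n * p) / t"
    have "e * (y + z) \<le> \<bar>y + z\<bar>" using e(1) by auto
    then have "b - \<bar>y + z\<bar> \<le> r - e * z" unfolding r_def using e xy by (simp add: algebra_simps)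
    from sq[OF this] have "(max 0 (b - \<bar>y + z\<bar>)) ^ 2 \<le> (max 0 r) ^ 2 - 2 * max 0 r * (e * z) + z ^ 2"
      using e(1) by auto
    then show "(max 0 (b - \<bar>y + (real k - real n * p) / t\<bar>)) ^ 2 \<le> (max 0 r) ^ 2 + (- 2 * max 0 r * e / t) * (real k - real n * p)
       + (1 / t ^ 2) * (real k - real n * p) ^ 2 + 0 * (real k - real n * p) ^ 4"
      unfolding z_def by (simp add: power_divide mult_ac)
  qed
  also have "\<dots> = (max 0 r) ^ 2 + p * (1 - p) * (n / t ^ 2)"
    by (subst expectation_binomial_quartic[OF p]) simp
  finally show ?thesis by (simp add: r_def)
qed

text \<open>In the units X = x^2 / V, Y = y^2 / V, r = n / (t^2 V), the drift from X to Y
  contributes at most 0 because \<kappa> (X + Y) \<le> 1. The variance contributes at most - (3/16)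
  \<kappa> r. Of this, \<kappa> r / 8 pays for the decrease of \<open>w\<close> by the noise of the
  step, and the remaining \<kappa> r / 16 covers the errors from the fourth power.\<close>

lemma expectation_escape_potential_le:
  fixes L V x y t p \<kappa> w :: real
  defines "\<kappa> \<equiv> 1 / (64 * L ^ 2)"
  assumes p: "0 \<le> p" "p \<le> 1" "3 / 16 \<le> p * (1 - p)" and n: "0 < n" and t: "0 < t"
    and L: "1 \<le> L" and V: "n / t ^ 2 \<le> V" and x: "x ^ 2 \<le> V" and y: "y ^ 2 \<le> L ^ 2 * V" "x ^ 2 \<le> y ^ 2"
  shows "measure_pmf.expectation (binomial_pmf n p)
      (\<lambda>k. 1 - \<kappa> * (y + (real k - real n * p) / t) ^ 2 / V
        + \<kappa> ^ 2 * (y + (real k - real n * p) / t) ^ 4 / V ^ 2 - \<kappa> / 8 * (w - n / t ^ 2) / V)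
    \<le> 1 - \<kappa> * x ^ 2 / V + \<kappa> ^ 2 * x ^ 4 / V ^ 2 - \<kappa> / 8 * w / V"
proof -
  have s_pos: "0 < n / t ^ 2" using n t by simp
  have V_pos: "0 < V" using s_pos V by simp
  define X Y r P where "X = x ^ 2 / V" and "Y = y ^ 2 / V" and "r = n / t ^ 2 / V" and "P = p * (1 - p)"
  have X: "0 \<le> X" "X \<le> 1" using x V_pos by (auto simp: X_def)
  have Y: "X \<le> Y" "Y \<le> L ^ 2" using y V_pos by (auto simp: X_def Y_def field_simps)
  have r: "0 < r" "r \<le> 1" unfolding r_def using divide_pos_pos[OF s_pos V_pos] V V_pos by (simp_all only: divide_le_eq_1_pos)
  have P: "3 / 16 \<le> P" "P \<le> 1 / 4" using p mult_one_minus_le[of p] by (auto simp: P_def)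
  have L2: "1 \<le> L ^ 2" using L by (simp add: one_le_power)
  then have \<kappa>: "0 < \<kappa>" "\<kappa> * L ^ 2 = 1 / 64" by (auto simp: \<kappa>_def)
  define m where "m = binomial_moment 4 n p / t ^ 4 / V ^ 2"
  \<comment> \<open>Since n \<ge> 1, n / 4 is absorbed into n^2 by 1/4 + 3/16 \<le> 1/2; then r
    \<le> 1 reduces r^2 to r.\<close>
  have m: "m \<le> r / 2"
  proof -
    have "binomial_moment 4 n p \<le> n / 4 + 3 * n ^ 2 / 16" using binomial_moment_4_le p by simp
    also have "\<dots> \<le> real n ^ 2 / 2"
    proof -
      have "real n \<le> real n ^ 2" using n by (simp add: power2_eq_square)
      then show ?thesis by (simp only: of_nat_mult of_nat_power of_nat_numeral)
    qed
    finally have "m \<le> (real n ^ 2 / 2) / t ^ 4 / V ^ 2"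
      unfolding m_def using t V_pos by (intro divide_right_mono) auto
    also have "\<dots> = r * r / 2" unfolding r_def using V_pos t by (simp add: field_simps eval_nat_numeral)
    also have "\<dots> \<le> r / 2" using r by (simp add: mult_left_le)
    finally show ?thesis .
  qed
  have "measure_pmf.expectation (binomial_pmf n p)
      (\<lambda>k. 1 - \<kappa> * (y + (real k - real n * p) / t) ^ 2 / V
        + \<kappa> ^ 2 * (y + (real k - real n * p) / t) ^ 4 / V ^ 2 - \<kappa> / 8 * (w - n / t ^ 2) / V)
    \<le> measure_pmf.expectation (binomial_pmf n p) (\<lambda>k.
        (1 - \<kappa> * y ^ 2 / V + \<kappa> ^ 2 * y ^ 4 / V ^ 2 - \<kappa> / 8 * (w - n / t ^ 2) / V)
        + (- 2 * \<kappa> * y / V / t + 4 * \<kappa> ^ 2 * y ^ 3 / V ^ 2 / t) * (real k - real n * p)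
        + (- \<kappa> / V / t ^ 2 + 8 * \<kappa> ^ 2 * y ^ 2 / V ^ 2 / t ^ 2) * (real k - real n * p) ^ 2
        + (3 * \<kappa> ^ 2 / V ^ 2 / t ^ 4) * (real k - real n * p) ^ 4)"
  proof (intro integral_mono integrable_binomial_pmf p)
    fix k
    define D where "D = real k - real n * p"
    define z where "z = D / t"
    have in_z: "(a / t + b / t) * D = (a + b) * z" "(a / t ^ 2 + b / t ^ 2) * D ^ 2 = (a + b) * z ^ 2"
      "a / t ^ 4 * D ^ 4 = a * z ^ 4" for a b
      by (simp_all add: z_def power_divide add_divide_distrib[symmetric])
    \<comment> \<open>Adding this square trades the cubic term 4 y z^3 of (y + z)^4 for multiples of
      y^2 z^2 and z^4.\<close>
    have "0 \<le> 2 * z ^ 2 * (y - z) ^ 2" by simp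
    then have q: "(y + z) ^ 4 \<le> y ^ 4 + 4 * y ^ 3 * z + 8 * y ^ 2 * z ^ 2 + 3 * z ^ 4"
      by (simp add: eval_nat_numeral algebra_simps)
    have "\<kappa> ^ 2 / V ^ 2 * (y + z) ^ 4 \<le> \<kappa> ^ 2 / V ^ 2 * (y ^ 4 + 4 * y ^ 3 * z + 8 * y ^ 2 * z ^ 2 + 3 * z ^ 4)"
      by (rule mult_left_mono[OF q]) simp
    moreover have "\<kappa> / V * (y + z) ^ 2 = \<kappa> / V * y ^ 2 + 2 * \<kappa> * y / V * z + \<kappa> / V * z ^ 2"
      by (simp add: power2_eq_square algebra_simps add_divide_distrib)
    ultimately have "1 - \<kappa> * (y + z) ^ 2 / V + \<kappa> ^ 2 * (y + z) ^ 4 / V ^ 2 - \<kappa> / 8 * (w - n / t ^ 2) / V \<le>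
        (1 - \<kappa> * y ^ 2 / V + \<kappa> ^ 2 * y ^ 4 / V ^ 2 - \<kappa> / 8 * (w - n / t ^ 2) / V)
        + (- 2 * \<kappa> * y / V + 4 * \<kappa> ^ 2 * y ^ 3 / V ^ 2) * z
        + (- \<kappa> / V + 8 * \<kappa> ^ 2 * y ^ 2 / V ^ 2) * z ^ 2 + (3 * \<kappa> ^ 2 / V ^ 2) * z ^ 4"
      by (simp add: algebra_simps)
    then show "1 - \<kappa> * (y + (real k - real n * p) / t) ^ 2 / V
        + \<kappa> ^ 2 * (y + (real k - real n * p) / t) ^ 4 / V ^ 2 - \<kappa> / 8 * (w - n / t ^ 2) / V \<le>
        (1 - \<kappa> * y ^ 2 / V + \<kappa> ^ 2 * y ^ 4 / V ^ 2 - \<kappa> / 8 * (w - n / t ^ 2) / V)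
        + (- 2 * \<kappa> * y / V / t + 4 * \<kappa> ^ 2 * y ^ 3 / V ^ 2 / t) * (real k - real n * p)
        + (- \<kappa> / V / t ^ 2 + 8 * \<kappa> ^ 2 * y ^ 2 / V ^ 2 / t ^ 2) * (real k - real n * p) ^ 2
        + (3 * \<kappa> ^ 2 / V ^ 2 / t ^ 4) * (real k - real n * p) ^ 4"
      unfolding D_def[symmetric] in_z z_def[symmetric] .
  qed
  also have "\<dots> = 1 - \<kappa> * Y + \<kappa> ^ 2 * Y ^ 2 - \<kappa> / 8 * (w / V - r)
      + (- \<kappa> + 8 * \<kappa> ^ 2 * Y) * (P * r) + 3 * \<kappa> ^ 2 * m"
    unfolding expectation_binomial_quartic[OF p(1,2)] X_def Y_def r_def P_def m_def
    using V_pos t by (simp add: field_simps eval_nat_numeral)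
  also have "\<dots> \<le> 1 - \<kappa> * X + \<kappa> ^ 2 * X ^ 2 - \<kappa> / 8 * (w / V)"
  proof -
    have "\<kappa> ^ 2 * (Y ^ 2 - X ^ 2) = \<kappa> * (Y - X) * (\<kappa> * (Y + X))"
      by (simp add: power2_eq_square algebra_simps)
    also have "\<dots> \<le> \<kappa> * (Y - X) * 1"
    proof (intro mult_left_mono)
      have "\<kappa> * (Y + X) \<le> \<kappa> * (2 * L ^ 2)" using Y X L2 \<kappa> by (intro mult_left_mono) auto
      also have "\<dots> = 2 * (\<kappa> * L ^ 2)" by simp
      finally show "\<kappa> * (Y + X) \<le> 1" unfolding \<kappa>(2) by simp
    qed (use \<kappa> Y in auto)
    finally have 1: "\<kappa> ^ 2 * (Y ^ 2 - X ^ 2) \<le> \<kappa> * (Y - X)" by simp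
    have "8 * \<kappa> ^ 2 * Y * (P * r) \<le> 8 * \<kappa> ^ 2 * L ^ 2 * (1 / 4 * r)"
      using Y X P r \<kappa> by (intro mult_mono) auto
    also have "\<dots> = 2 * (\<kappa> ^ 2 * L ^ 2 * r)" by simp
    finally have 21: "8 * \<kappa> ^ 2 * Y * (P * r) \<le> 2 * (\<kappa> ^ 2 * L ^ 2 * r)" .
    have "1 * r \<le> L ^ 2 * r" using L2 r by (intro mult_right_mono) auto
    then have "3 * \<kappa> ^ 2 * m \<le> 3 * \<kappa> ^ 2 * (L ^ 2 * r / 2)"
      using m by (intro mult_left_mono) auto
    also have "\<dots> = 3 / 2 * (\<kappa> ^ 2 * L ^ 2 * r)" by simp
    finally have 22: "3 * \<kappa> ^ 2 * m \<le> 3 / 2 * (\<kappa> ^ 2 * L ^ 2 * r)" .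
    \<comment> \<open>The factor 64 in \<open>\<kappa>\<close> is chosen for this: the errors total
      (2 + 3/2) \<kappa>^2 L^2 r = (7/128) \<kappa> r, just under \<kappa> r / 16.\<close>
    have "\<kappa> ^ 2 * L ^ 2 * r = \<kappa> * r / 64" using \<kappa>(2) by (simp add: power2_eq_square)
    moreover have "0 \<le> \<kappa> * r" using \<kappa> r by simp
    ultimately have 2: "8 * \<kappa> ^ 2 * Y * (P * r) + 3 * \<kappa> ^ 2 * m \<le> \<kappa> * r / 16"
      using 21 22 by linarith
    have 3: "\<kappa> * (3 / 16 * r) \<le> \<kappa> * (P * r)"
      using \<kappa> r P by (intro mult_left_mono mult_right_mono) auto
    have "\<kappa> ^ 2 * (Y ^ 2 - X ^ 2) = \<kappa> ^ 2 * Y ^ 2 - \<kappa> ^ 2 * X ^ 2" "\<kappa> * (Y - X) = \<kappa> * Y - \<kappa> * X"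
      "\<kappa> / 8 * (w / V - r) = \<kappa> / 8 * (w / V) - \<kappa> * r / 8"
      "(- \<kappa> + 8 * \<kappa> ^ 2 * Y) * (P * r) = 8 * \<kappa> ^ 2 * Y * (P * r) - \<kappa> * (P * r)"
      "\<kappa> * (3 / 16 * r) = 3 / 16 * (\<kappa> * r)"
      by (simp_all add: algebra_simps diff_divide_distrib)
    then show ?thesis using 1 2 3 by linarith
  qed
  finally show ?thesis by (simp add: X_def power_divide power_mult[symmetric])
qed

section \<open>Supermartingales and a zero-one law\<close>

text \<open>The sets that can be approximated at arbitrarily late levels form a sigma-algebra
  containing every \<open>F n\<close>. For a countable union, a finite part carries all but
  \<open>e / 2\<close> of the probability, and its members are approximated one by one at a common
  level.\<close>

lemma (in prob_space) approx_by_filtration: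
  fixes F :: "nat \<Rightarrow> 'a measure"
  assumes sub: "\<And>n. subalgebra M (F n)" and mono: "\<And>m n. m \<le> n \<Longrightarrow> sets (F m) \<subseteq> sets (F n)"
    and A: "A \<in> sigma_sets (space M) (\<Union>n. sets (F n))" and e: "(0::real) < e"
  shows "\<exists>n\<ge>N. \<exists>D\<in>sets (F n). prob (sym_diff A D) < e"
proof -
  have FM: "sets (F n) \<subseteq> events" "space (F n) = space M" for n
    using sub[of n] by (auto simp: subalgebra_def)
  have in_M: "A \<in> events" if "A \<in> sigma_sets (space M) (\<Union>n. sets (F n))" for A
    using that FM(1) sets.sigma_sets_subset[of "\<Union>n. sets (F n)" M] by blast
  show ?thesis using A e
  proof (induction A arbitrary: e rule: sigma_sets.induct)
    case (Basic a)
    then obtain n where "a \<in> sets (F n)" by blast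
    then have "a \<in> sets (F (max n N))" using mono[of n "max n N"] by auto
    then show ?case using Basic by (intro exI[of _ "max n N"] conjI bexI[of _ a]) auto
  next
    case Empty
    then show ?case by (intro exI[of _ N] conjI bexI[of _ "{}"]) auto
  next
    case (Compl a)
    then obtain n D where D: "n \<ge> N" "D \<in> sets (F n)" "prob (sym_diff a D) < e" by blast
    have "sym_diff (space M - a) (space M - D) = sym_diff a D"
      using sets.sets_into_space[OF in_M[OF Compl.hyps]] sets.sets_into_space[of D "F n"] D(2) FM(2)[of n]
      by auto
    then show ?case using D FM(2)[of n] sets.compl_sets[OF D(2)]
      by (intro exI[of _ n] conjI bexI[of _ "space M - D"]) auto
  next
    case (Union a)
    have a: "a i \<in> events" for i using Union.hyps in_M by blast
    have "(\<lambda>k. prob (\<Union>i<k. a i)) \<longlonglongrightarrow> prob (\<Union>k. \<Union>i<k. a i)"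
      using a by (intro finite_Lim_measure_incseq) (auto simp: incseq_def, meson lessThan_iff less_le_trans)
    also have "(\<Union>k. \<Union>i<k. a i) = (\<Union>i. a i)" by blast
    finally have "eventually (\<lambda>k. prob (\<Union>i. a i) - e / 2 < prob (\<Union>i<k. a i)) sequentially"
      using \<open>0 < e\<close> by (intro order_tendstoD(1)) auto
    then obtain k where k: "prob (\<Union>i. a i) - e / 2 < prob (\<Union>i<k. a i)"
      by (auto simp: eventually_sequentially)
    have rest: "prob ((\<Union>i. a i) - (\<Union>i<k. a i)) < e / 2"
      using k a by (subst finite_measure_Diff) auto
    \<comment> \<open>The summand 1 keeps \<open>e'\<close> positive for \<open>k = 0\<close>; the
      \<open>k\<close> errors add up to at most \<open>e / 2\<close>.\<close>
    define e' where "e' = e / (2 * (real k + 1))"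
    have e': "0 < e'" using \<open>0 < e\<close> by (simp add: e'_def)
    have "\<forall>i. \<exists>n D. n \<ge> N \<and> D \<in> sets (F n) \<and> prob (sym_diff (a i) D) < e'"
      using Union.IH[OF e'] by blast
    then obtain n D where D: "\<And>i. n i \<ge> N" "\<And>i. D i \<in> sets (F (n i))"
      "\<And>i. prob (sym_diff (a i) (D i)) < e'" by metis
    define m where "m = N + (\<Sum>i<k. n i)"
    have Dm: "D i \<in> sets (F m)" if "i < k" for i
    proof -
      have "n i \<le> m" unfolding m_def using that member_le_sum[of i "{..<k}" n] by simp
      then show ?thesis using mono D(2) by blast
    qed
    have D_ev: "D i \<in> events" for i using D(2) FM(1) by blast
    have "prob (sym_diff (\<Union>i. a i) (\<Union>i<k. D i))
        \<le> prob (((\<Union>i. a i) - (\<Union>i<k. a i)) \<union> (\<Union>i<k. sym_diff (a i) (D i)))"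
      using a D_ev by (intro finite_measure_mono) auto
    also have "\<dots> \<le> prob ((\<Union>i. a i) - (\<Union>i<k. a i)) + prob (\<Union>i<k. sym_diff (a i) (D i))"
      using a D_ev by (intro measure_Un_le) auto
    also have "prob (\<Union>i<k. sym_diff (a i) (D i)) \<le> (\<Sum>i<k. prob (sym_diff (a i) (D i)))"
      using a D_ev by (intro finite_measure_subadditive_finite) auto
    also have "\<dots> \<le> (\<Sum>i<k. e')" using D(3) by (intro sum_mono less_imp_le)
    also have "\<dots> \<le> e / 2" using \<open>0 < e\<close> by (simp add: e'_def field_simps)
    finally have "prob (sym_diff (\<Union>i. a i) (\<Union>i<k. D i)) < e" using rest by simp
    moreover have "(\<Union>i<k. D i) \<in> sets (F m)" using Dm by auto
    ultimately show ?case by (intro exI[of _ m] conjI bexI[of _ "\<Union>i<k. D i"]) (auto simp: m_def)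
  qed
qed

text \<open>A form of Levy's zero-one law that needs no conditional expectations: \<open>A\<close> itself is
  approximated by the events \<open>D\<close>.\<close>

lemma (in prob_space) prob_zero_if_conditionally_bounded:
  fixes F :: "nat \<Rightarrow> 'a measure" and q :: real
  assumes sub: "\<And>n. subalgebra M (F n)" and mono: "\<And>m n. m \<le> n \<Longrightarrow> sets (F m) \<subseteq> sets (F n)"
    and A: "A \<in> sigma_sets (space M) (\<Union>n. sets (F n))" and q: "0 \<le> q" "q < 1"
    and bound: "\<And>n D. n \<ge> N \<Longrightarrow> D \<in> sets (F n) \<Longrightarrow> prob (A \<inter> D) \<le> q * prob D"
  shows "prob A = 0"
proof (rule ccontr)
  assume "prob A \<noteq> 0"
  then have pos: "0 < prob A" by (simp add: zero_less_measure_iff)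
  \<comment> \<open>The estimate below amounts to (1 - q) \<open>prob A\<close> \<le>
    \<open>prob (sym_diff A D)\<close>, so half of the left side is a contradictory upper bound for
    the right.\<close>
  define e where "e = (1 - q) * prob A / 2"
  have "0 < e" using pos q by (simp add: e_def)
  then obtain n D where D: "n \<ge> N" "D \<in> sets (F n)" and less: "prob (sym_diff A D) < e"
    using approx_by_filtration[OF sub mono A, of e N] by blast
  have D_ev: "D \<in> events" using D sub[of n] by (auto simp: subalgebra_def)
  have A_ev: "A \<in> events"
    using A sub sets.sigma_sets_subset[of "\<Union>n. sets (F n)" M] by (auto simp: subalgebra_def)
  have "prob A \<le> prob ((A \<inter> D) \<union> (A - D))"
    using A_ev D_ev by (intro finite_measure_mono) auto
  also have "\<dots> = prob (A \<inter> D) + prob (A - D)"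
    using A_ev D_ev by (intro finite_measure_Union) auto
  also have "prob (A \<inter> D) \<le> q * prob D" by (rule bound[OF D])
  also have "q * prob D \<le> q * prob (A \<union> (D - A))"
    using A_ev D_ev q by (intro mult_left_mono finite_measure_mono) auto
  also have "prob (A \<union> (D - A)) = prob A + prob (D - A)"
    using A_ev D_ev by (intro finite_measure_Union) auto
  also have "q * (prob A + prob (D - A)) \<le> q * prob A + prob (D - A)"
    using q mult_left_le_one_le[of "prob (D - A)" q] by (simp add: algebra_simps)
  finally have "prob A \<le> q * prob A + (prob (A - D) + prob (D - A))" by simp
  also have "prob (A - D) + prob (D - A) = prob (sym_diff A D)"
    using A_ev D_ev by (intro finite_measure_Union[symmetric]) auto
  finally show False using less \<open>0 < e\<close> by (simp add: e_def algebra_simps)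
qed

text \<open>Doob's maximal inequality for nonnegative supermartingales, localised to an event
  \<open>D\<close> known at time \<open>n\<close>. The supermartingale property is stated through
  integrals over events of \<open>F k\<close>, the form used by the induction on the horizon:
  Markov's inequality handles the part of \<open>D\<close> where the level is already reached, and
  the rest is moved on by one step.\<close>

lemma (in prob_space) prob_le_supermartingale:
  fixes F :: "nat \<Rightarrow> 'a measure" and Z :: "nat \<Rightarrow> 'a \<Rightarrow> real"
  assumes sub: "\<And>n. subalgebra M (F n)" and mono: "\<And>m n. m \<le> n \<Longrightarrow> sets (F m) \<subseteq> sets (F n)"
    and Z: "\<And>k. k \<ge> n \<Longrightarrow> Z k \<in> borel_measurable (F k)" "\<And>k. k \<ge> n \<Longrightarrow> integrable M (Z k)" "\<And>k \<omega>. 0 \<le> Z k \<omega>"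
    and super: "\<And>k D. k \<ge> n \<Longrightarrow> D \<in> sets (F k) \<Longrightarrow>
      (\<integral>\<omega>. indicator D \<omega> * Z (Suc k) \<omega> \<partial>M) \<le> (\<integral>\<omega>. indicator D \<omega> * Z k \<omega> \<partial>M)"
    and c: "0 < c" and D: "D \<in> sets (F n)"
  shows "c * prob {\<omega>\<in>D. \<exists>k\<ge>n. c \<le> Z k \<omega>} \<le> (\<integral>\<omega>. indicator D \<omega> * Z n \<omega> \<partial>M)"
proof -
  have sp: "space (F k) = space M" for k
    using sub[of k] by (auto simp: subalgebra_def)
  have FM: "D \<in> events" if "D \<in> sets (F k)" for k D
    using that sub[of k] by (auto simp: subalgebra_def)
  have ZM: "Z k \<in> borel_measurable M" if "k \<ge> n" for k
    using Z(1)[OF that] sub by (rule measurable_from_subalg[rotated])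
  have level: "{\<omega>\<in>D. c \<le> Z k \<omega>} \<in> sets (F k)" if "k \<ge> n" "D \<in> sets (F k)" for k D
  proof -
    have "D \<inter> {\<omega>\<in>space (F k). c \<le> Z k \<omega>} \<in> sets (F k)" using Z(1)[OF that(1)] that(2) by measurable
    moreover have "D \<inter> {\<omega>\<in>space (F k). c \<le> Z k \<omega>} = {\<omega>\<in>D. c \<le> Z k \<omega>}"
      using sets.sets_into_space[OF that(2)] by auto
    ultimately show ?thesis by simp
  qed
  have ind_int: "integrable M (\<lambda>\<omega>. indicator D \<omega> * Z k \<omega>)" if "k \<ge> n" "D \<in> events" for k D
    using integrable_mult_indicator[OF that(2) Z(2)[OF that(1)]] by simp
  have ev: "{\<omega>\<in>D. \<exists>k\<in>I. c \<le> Z k \<omega>} \<in> events" if "D \<in> events" "I \<subseteq> {n..}" for D I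
  proof -
    have "D \<inter> (\<Union>k\<in>I. {\<omega>\<in>space M. c \<le> Z k \<omega>}) \<in> events"
      using that ZM by (intro sets.Int sets.countable_UN) (auto intro!: borel_measurable_le)
    moreover have "D \<inter> (\<Union>k\<in>I. {\<omega>\<in>space M. c \<le> Z k \<omega>}) = {\<omega>\<in>D. \<exists>k\<in>I. c \<le> Z k \<omega>}"
      using sets.sets_into_space[OF that(1)] by auto
    ultimately show ?thesis by simp
  qed
  have first: "c * prob {\<omega>\<in>D. c \<le> Z l \<omega>} \<le> (\<integral>\<omega>. indicator {\<omega>\<in>D. c \<le> Z l \<omega>} \<omega> * Z l \<omega> \<partial>M)"
    if "l \<ge> n" "D \<in> sets (F l)" for l D
  proof -
    have E: "{\<omega>\<in>D. c \<le> Z l \<omega>} \<in> events" by (rule FM[OF level[OF that]])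
    then have "c * prob {\<omega>\<in>D. c \<le> Z l \<omega>} = (\<integral>\<omega>. c * indicator {\<omega>\<in>D. c \<le> Z l \<omega>} \<omega> \<partial>M)"
      by (simp add: sets.Int_space_eq1)
    also have "\<dots> \<le> (\<integral>\<omega>. indicator {\<omega>\<in>D. c \<le> Z l \<omega>} \<omega> * Z l \<omega> \<partial>M)"
      using E that by (intro integral_mono ind_int integrable_mult_right integrable_real_indicator)
        (auto simp: indicator_def less_top[symmetric])
    finally show ?thesis .
  qed
  have finite_horizon: "c * prob {\<omega>\<in>D. \<exists>k\<in>{l..l + m}. c \<le> Z k \<omega>} \<le> (\<integral>\<omega>. indicator D \<omega> * Z l \<omega> \<partial>M)"
    if "l \<ge> n" "D \<in> sets (F l)" for l m D
    using that
  \<comment> \<open>Start and event are generalised, since the rest \<open>D - ?D1\<close> is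
    treated as an event at time \<open>Suc l\<close>.\<close>
  proof (induction m arbitrary: l D)
    case 0
    have "c * prob {\<omega>\<in>D. c \<le> Z l \<omega>} \<le> (\<integral>\<omega>. indicator {\<omega>\<in>D. c \<le> Z l \<omega>} \<omega> * Z l \<omega> \<partial>M)"
      by (rule first[OF 0])
    also have "\<dots> \<le> (\<integral>\<omega>. indicator D \<omega> * Z l \<omega> \<partial>M)"
      using FM[OF level[OF 0]] FM[OF 0(2)] 0(1) Z(3)
      by (intro integral_mono ind_int) (auto simp: indicator_def)
    finally show ?case by simp
  next
    case (Suc m)
    let ?D1 = "{\<omega>\<in>D. c \<le> Z l \<omega>}"
    have D1: "?D1 \<in> sets (F l)" by (rule level[OF Suc.prems])
    then have D2: "D - ?D1 \<in> sets (F l)" "D - ?D1 \<in> sets (F (Suc l))"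
      using Suc.prems mono[of l "Suc l"] by auto
    note D1_ev = FM[OF D1] and D2_ev = FM[OF D2(1)]
    have ev2: "{\<omega>\<in>D - ?D1. \<exists>k\<in>{Suc l..Suc l + m}. c \<le> Z k \<omega>} \<in> events"
      using Suc.prems by (intro ev D2_ev) auto
    have "{l..l + Suc m} = insert l {Suc l..Suc l + m}" by auto
    then have "{\<omega>\<in>D. \<exists>k\<in>{l..l + Suc m}. c \<le> Z k \<omega>}
        \<subseteq> ?D1 \<union> {\<omega>\<in>D - ?D1. \<exists>k\<in>{Suc l..Suc l + m}. c \<le> Z k \<omega>}"
      by (simp only:) blast
    then have "prob {\<omega>\<in>D. \<exists>k\<in>{l..l + Suc m}. c \<le> Z k \<omega>}
        \<le> prob (?D1 \<union> {\<omega>\<in>D - ?D1. \<exists>k\<in>{Suc l..Suc l + m}. c \<le> Z k \<omega>})"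
      using D1_ev ev2 by (intro finite_measure_mono sets.Un)
    also have "\<dots> \<le> prob ?D1 + prob {\<omega>\<in>D - ?D1. \<exists>k\<in>{Suc l..Suc l + m}. c \<le> Z k \<omega>}"
      using D1_ev ev2 by (intro measure_Un_le) auto
    finally have "c * prob {\<omega>\<in>D. \<exists>k\<in>{l..l + Suc m}. c \<le> Z k \<omega>}
        \<le> c * prob ?D1 + c * prob {\<omega>\<in>D - ?D1. \<exists>k\<in>{Suc l..Suc l + m}. c \<le> Z k \<omega>}"
      using c by (simp add: distrib_left[symmetric])
    also have "c * prob ?D1 \<le> (\<integral>\<omega>. indicator ?D1 \<omega> * Z l \<omega> \<partial>M)"
      by (rule first[OF Suc.prems])
    also have "c * prob {\<omega>\<in>D - ?D1. \<exists>k\<in>{Suc l..Suc l + m}. c \<le> Z k \<omega>}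
        \<le> (\<integral>\<omega>. indicator (D - ?D1) \<omega> * Z (Suc l) \<omega> \<partial>M)"
      using Suc.prems D2 by (intro Suc.IH) auto
    also have "\<dots> \<le> (\<integral>\<omega>. indicator (D - ?D1) \<omega> * Z l \<omega> \<partial>M)"
      using Suc.prems D2 by (intro super) auto
    also have "(\<integral>\<omega>. indicator ?D1 \<omega> * Z l \<omega> \<partial>M) + (\<integral>\<omega>. indicator (D - ?D1) \<omega> * Z l \<omega> \<partial>M)
        = (\<integral>\<omega>. indicator ?D1 \<omega> * Z l \<omega> + indicator (D - ?D1) \<omega> * Z l \<omega> \<partial>M)"
      using D1_ev D2_ev Suc.prems by (intro Bochner_Integration.integral_add[symmetric] ind_int) auto
    also have "\<dots> = (\<integral>\<omega>. indicator D \<omega> * Z l \<omega> \<partial>M)"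
      by (intro Bochner_Integration.integral_cong) (auto simp: indicator_def)
    finally show ?case by simp
  qed
  have D_ev: "D \<in> events" by (rule FM[OF D])
  have "(\<lambda>m. prob {\<omega>\<in>D. \<exists>k\<in>{n..n + m}. c \<le> Z k \<omega>}) \<longlonglongrightarrow> prob (\<Union>m. {\<omega>\<in>D. \<exists>k\<in>{n..n + m}. c \<le> Z k \<omega>})"
  proof (intro finite_Lim_measure_incseq)
    show "incseq (\<lambda>m. {\<omega>\<in>D. \<exists>k\<in>{n..n + m}. c \<le> Z k \<omega>})"
      by (intro incseq_SucI) force
  qed (use ev[OF D_ev] in auto)
  also have "(\<Union>m. {\<omega>\<in>D. \<exists>k\<in>{n..n + m}. c \<le> Z k \<omega>}) = {\<omega>\<in>D. \<exists>k\<ge>n. c \<le> Z k \<omega>}"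
  proof safe
    fix \<omega> k assume "n \<le> k" "c \<le> Z k \<omega>" "\<omega> \<in> D"
    then show "\<omega> \<in> (\<Union>m. {\<omega>\<in>D. \<exists>k\<in>{n..n + m}. c \<le> Z k \<omega>})"
      by (intro UN_I[of "k - n"] CollectI conjI bexI[of _ k]) auto
  qed auto
  finally have "(\<lambda>m. c * prob {\<omega>\<in>D. \<exists>k\<in>{n..n + m}. c \<le> Z k \<omega>}) \<longlonglongrightarrow> c * prob {\<omega>\<in>D. \<exists>k\<ge>n. c \<le> Z k \<omega>}"
    by (intro tendsto_mult_left)
  then show ?thesis by (rule LIMSEQ_le_const2) (use finite_horizon[OF _ D] in auto)
qed

section \<open>A potential near the unstable point\<close>

text \<open>Here \<open>V\<close> is the noise to come after a fixed reference time and \<open>w\<close> the noise to come after the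
  present one. The first function decreases in mean along steps that start within distance \<open>sqrt V\<close>
  of the unstable point, where its quadratic term dominates. The second is Chebyshev's bound on the
  probability of ever returning to the unstable point and decreases in mean everywhere. Their minimum
  decreases in mean as well, since the second is the smaller one wherever the first fails to.\<close>

definition return_potential :: "real \<Rightarrow> real \<Rightarrow> real \<Rightarrow> real \<Rightarrow> real" where
  "return_potential \<kappa> V w x =
    min (1 - \<kappa> * x ^ 2 / V + \<kappa> ^ 2 * x ^ 4 / V ^ 2 - \<kappa> / 8 * w / V)
      (((max 0 (sqrt V - \<bar>x\<bar>)) ^ 2 + w / 4) / V)"

text \<open>This is the purpose of the fourth power: 1 - z + z^2 never drops below 3/4, whereas 1 -
  z would be unbounded below. The \<open>w\<close> term costs at most 1/8. The bound lets the
  Chebyshev part win the minimum at large distances.\<close>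

lemma escape_potential_ge_half:
  fixes \<kappa> V w x :: real
  assumes "0 < V" "0 \<le> \<kappa>" "\<kappa> \<le> 1" "w \<le> V"
  shows "1 / 2 \<le> 1 - \<kappa> * x ^ 2 / V + \<kappa> ^ 2 * x ^ 4 / V ^ 2 - \<kappa> / 8 * w / V"
proof -
  define z where "z = \<kappa> * x ^ 2 / V"
  have "\<kappa> ^ 2 * x ^ 4 / V ^ 2 = z ^ 2"
    by (simp add: z_def power_divide power_mult_distrib flip: power_mult)
  moreover have "1 - z + z ^ 2 = (z - 1 / 2) ^ 2 + 3 / 4"
    by (simp add: power2_eq_square algebra_simps)
  moreover have "\<kappa> / 8 * w / V \<le> 1 / 8"
  proof -
    have "\<kappa> * w \<le> \<kappa> * V" using assms by (intro mult_left_mono)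
    also have "\<dots> \<le> V" using assms by (simp add: mult_left_le_one_le)
    finally have "\<kappa> * w \<le> V" .
    then show ?thesis using assms by (simp add: divide_le_eq)
  qed
  ultimately show ?thesis using zero_le_power2[of "z - 1 / 2"] unfolding z_def[symmetric] by linarith
qed

lemma return_potential_nonneg:
  assumes "0 < V" "0 \<le> \<kappa>" "\<kappa> \<le> 1" "0 \<le> w" "w \<le> V"
  shows "0 \<le> return_potential \<kappa> V w x"
  using escape_potential_ge_half[OF assms(1-3) assms(5), of x] assms by (simp add: return_potential_def)

lemma return_potential_le_2:
  assumes "0 < V" "w \<le> V"
  shows "return_potential \<kappa> V w x \<le> 2"
proof -
  have "(max 0 (sqrt V - \<bar>x\<bar>)) ^ 2 \<le> (sqrt V) ^ 2" using assms by (intro power_mono) auto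
  then have "((max 0 (sqrt V - \<bar>x\<bar>)) ^ 2 + w / 4) / V \<le> 2" using assms by (simp add: divide_le_eq)
  then show ?thesis by (simp add: return_potential_def)
qed

text \<open>Beyond sqrt V the positive part vanishes, so the second argument of the minimum is w /
  (4 V) \<le> 1/4, while the first is at least 1/2.\<close>

lemma return_potential_far:
  assumes "0 < V" "0 \<le> \<kappa>" "\<kappa> \<le> 1" "w \<le> V" "V < x ^ 2"
  shows "return_potential \<kappa> V w x = ((max 0 (sqrt V - \<bar>x\<bar>)) ^ 2 + w / 4) / V"
    and "return_potential \<kappa> V w x \<le> 1 / 4"
proof -
  have "sqrt V \<le> \<bar>x\<bar>" using assms by (metis real_sqrt_abs real_sqrt_le_iff less_imp_le)
  then have 1: "((max 0 (sqrt V - \<bar>x\<bar>)) ^ 2 + w / 4) / V \<le> 1 / 4" using assms by (simp add: divide_le_eq)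
  then show "return_potential \<kappa> V w x = ((max 0 (sqrt V - \<bar>x\<bar>)) ^ 2 + w / 4) / V"
    unfolding return_potential_def using escape_potential_ge_half[OF assms(1-4), of x]
    by (intro min_absorb2) linarith
  with 1 show "return_potential \<kappa> V w x \<le> 1 / 4" by simp
qed

text \<open>With \<open>w = V\<close> the subtracted term is exactly \<open>\<kappa> / 8\<close>,
  and z^2 \<le> z for z in [0, 1]. Beyond sqrt V the value is at most 1/4 anyway.\<close>

lemma return_potential_initial:
  assumes "0 < V" "0 \<le> \<kappa>" "\<kappa> \<le> 1"
  shows "return_potential \<kappa> V V x \<le> 1 - \<kappa> / 8"
proof (cases "x ^ 2 \<le> V")
  case True
  define z where "z = \<kappa> * x ^ 2 / V"
  have "x ^ 2 / V \<le> 1" using True assms by simp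
  then have "\<kappa> * (x ^ 2 / V) \<le> 1 * 1" using assms by (intro mult_mono) auto
  then have z: "0 \<le> z" "z \<le> 1" using assms by (auto simp: z_def)
  have "1 - \<kappa> * x ^ 2 / V + \<kappa> ^ 2 * x ^ 4 / V ^ 2 - \<kappa> / 8 * V / V = 1 - z + z * z - \<kappa> / 8"
    using assms by (simp add: z_def power2_eq_square eval_nat_numeral)
  also have "\<dots> \<le> 1 - \<kappa> / 8" using z by (simp add: mult_left_le)
  finally show ?thesis by (simp add: return_potential_def)
next
  case False
  then show ?thesis using return_potential_far(2)[of V \<kappa> V x] assms by simp
qed

text \<open>Both arguments of the minimum tend to 1, so a path with limit 1/2 carries the potential
  above every level below 1.\<close>

lemma tendsto_return_potential:
  assumes "0 < V" "w \<longlonglongrightarrow> 0" "x \<longlonglongrightarrow> 0"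
  shows "(\<lambda>n. return_potential \<kappa> V (w n) (x n)) \<longlonglongrightarrow> 1"
proof -
  have "(\<lambda>n. return_potential \<kappa> V (w n) (x n)) \<longlonglongrightarrow>
      min (1 - \<kappa> * 0 ^ 2 / V + \<kappa> ^ 2 * 0 ^ 4 / V ^ 2 - \<kappa> / 8 * 0 / V)
        (((max 0 (sqrt V - \<bar>0\<bar>)) ^ 2 + 0 / 4) / V)"
    unfolding return_potential_def using assms by (intro tendsto_intros) auto
  then show ?thesis using assms by simp
qed

lemma measurable_return_potential [measurable]:
  "return_potential \<kappa> V w \<in> borel_measurable borel"
  unfolding return_potential_def[abs_def] by measurable

section \<open>Convergence of the proportion\<close>

context balls_and_bins
begin

section \<open>Notation, step weights and remaining noise\<close>

abbreviation \<tau> :: "nat \<Rightarrow> nat" where "\<tau> \<equiv> total_balls \<sigma> \<tau>0"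
abbreviation \<Theta> :: "nat \<Rightarrow> 'a \<Rightarrow> real" where "\<Theta> \<equiv> proportion \<sigma> \<tau>0 T0 B"
abbreviation \<F> :: "nat \<Rightarrow> 'a measure" where "\<F> \<equiv> history M B"

text \<open>The denominator is the total after the step, unlike in \<open>growth_ratio\<close>: the
  new proportion averages the old one and \<open>B (Suc n) / \<sigma> (Suc n)\<close>, with weight
  \<open>gain n\<close> on the latter.\<close>

definition gain :: "nat \<Rightarrow> real" where
  "gain n = real (\<sigma> (Suc n)) / real (\<tau> (Suc n))"

definition noise :: "nat \<Rightarrow> real" where
  "noise n = real (\<sigma> (Suc n)) / real (\<tau> (Suc n)) ^ 2"

definition tail_noise :: "nat \<Rightarrow> real" where
  "tail_noise n = (\<Sum>k. noise (k + n))"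

lemma \<tau>_Suc: "\<tau> (Suc n) = \<tau> n + \<sigma> (Suc n)"
  by (simp add: total_balls_def)

lemma \<tau>_pos: "0 < \<tau> n"
  using initial by (simp add: total_balls_def)

lemma \<sigma>_Suc_pos: "0 < \<sigma> (Suc n)"
  by (rule step_size_pos) simp

lemma \<tau>_ge: "n \<le> \<tau> n"
proof (induction n)
  case (Suc n)
  then show ?case using \<sigma>_Suc_pos[of n] by (simp add: \<tau>_Suc)
qed simp

lemma gain_bounds: "0 \<le> gain n" "gain n \<le> 1"
  using \<tau>_pos[of "Suc n"] by (auto simp: gain_def \<tau>_Suc divide_le_eq)

text \<open>The decrements of \<open>\<tau> N / \<tau> n\<close> in \<open>n\<close> are bounded by
  \<open>gain\<close>, so the sum from \<open>N\<close> up to \<open>n\<close> is at least 1 -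
  \<open>\<tau> N / \<tau> n\<close>. As \<open>\<tau>\<close> is unbounded, sums from every start
  reach 1/2, against the Cauchy criterion.\<close>

lemma not_summable_gain: "\<not> summable gain"
proof
  assume "summable gain"
  then obtain N where N: "\<And>m n. m \<ge> N \<Longrightarrow> norm (sum gain {m..<n}) < 1 / 2"
    by (metis summable_Cauchy half_gt_zero zero_less_one)
  have lower: "1 - real (\<tau> N) / real (\<tau> n) \<le> sum gain {N..<n}" if "N \<le> n" for n
    using that
  proof (induction n rule: dec_induct)
    case base
    then show ?case using \<tau>_pos[of N] by simp
  next
    case (step n)
    have "\<tau> N \<le> \<tau> n" using step.hyps by (simp add: total_balls_def sum_mono2)
    define b s where "b = real (\<tau> n)" and "s = real (\<sigma> (Suc n))"
    have bs: "0 < b" "0 < s" "real (\<tau> N) \<le> b" "real (\<tau> (Suc n)) = b + s"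
      using \<tau>_pos[of n] \<sigma>_Suc_pos[of n] \<open>\<tau> N \<le> \<tau> n\<close> by (auto simp: b_def s_def \<tau>_Suc)
    have "real (\<tau> N) / b - real (\<tau> N) / (b + s) = s * real (\<tau> N) / (b * (b + s))"
      using bs by (simp add: field_simps)
    also have "\<dots> \<le> s * b / (b * (b + s))"
      using bs by (intro divide_right_mono mult_left_mono) auto
    also have "\<dots> = gain n" using bs by (simp add: gain_def s_def)
    finally have "real (\<tau> N) / \<tau> n - real (\<tau> N) / \<tau> (Suc n) \<le> gain n"
      using bs by (simp add: b_def)
    then show ?case using step by simp
  qed
  \<comment> \<open>Chosen so that \<open>n \<le> \<tau> n\<close> yields
    \<open>2 * \<tau> N \<le> \<tau> n\<close>.\<close>
  define n where "n = N + 2 * \<tau> N"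
  have "2 * \<tau> N \<le> \<tau> n" using \<tau>_ge[of n] by (simp add: n_def)
  then have "real (\<tau> N) / real (\<tau> n) \<le> 1 / 2"
    using \<tau>_pos[of n] by (simp add: divide_le_eq)
  then show False using lower[of n] N[of N n] by (simp add: n_def)
qed

lemma noise_pos: "0 < noise n"
  using \<tau>_pos \<sigma>_Suc_pos by (simp add: noise_def)

lemma summable_noise: "summable noise"
proof (rule bounded_imp_summable)
  fix n
  have "noise k \<le> 1 / \<tau> k - 1 / \<tau> (Suc k)" for k
  proof -
    have "1 / \<tau> k - 1 / \<tau> (Suc k) = \<sigma> (Suc k) / (\<tau> k * \<tau> (Suc k))"
      using \<tau>_pos[of k] \<tau>_pos[of "Suc k"] by (simp add: \<tau>_Suc field_simps)
    moreover have "noise k \<le> \<sigma> (Suc k) / (\<tau> k * \<tau> (Suc k))"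
      unfolding noise_def power2_eq_square using \<tau>_pos[of k]
      by (intro divide_left_mono mult_right_mono mult_pos_pos) (auto simp: \<tau>_Suc)
    ultimately show ?thesis by simp
  qed
  then have "(\<Sum>k\<le>n. noise k) \<le> (\<Sum>k\<le>n. 1 / \<tau> k - 1 / \<tau> (Suc k))"
    by (rule sum_mono)
  also have "\<dots> = 1 / \<tau> 0 - 1 / \<tau> (Suc n)" by (rule sum_telescope)
  also have "\<dots> \<le> 1 / \<tau> 0" by simp
  also have "\<dots> \<le> 1" using \<tau>_pos[of 0] by simp
  finally show "(\<Sum>k\<le>n. noise k) \<le> 1" .
qed (simp add: noise_pos less_imp_le)

lemma tail_noise_Suc: "tail_noise n = noise n + tail_noise (Suc n)"
  unfolding tail_noise_def
  using suminf_split_head[of "\<lambda>k. noise (k + n)"] summable_noise by (simp add: summable_iff_shift)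

lemma tail_noise_nonneg: "0 \<le> tail_noise n"
  unfolding tail_noise_def using summable_noise
  by (intro suminf_nonneg) (auto simp: summable_iff_shift noise_pos less_imp_le)

lemma tail_noise_antimono: "m \<le> n \<Longrightarrow> tail_noise n \<le> tail_noise m"
proof (rule lift_Suc_antimono_le[of tail_noise])
  show "tail_noise (Suc k) \<le> tail_noise k" for k
    using tail_noise_Suc[of k] noise_pos[of k] by simp
qed

lemma noise_le_tail_noise: "m \<le> n \<Longrightarrow> noise n \<le> tail_noise m"
  using tail_noise_antimono[of m n] tail_noise_Suc[of n] tail_noise_nonneg[of "Suc n"] by simp

lemma tail_noise_pos: "0 < tail_noise n"
  using noise_le_tail_noise[of n n] noise_pos[of n] by simp

lemma tail_noise_tendsto_0: "tail_noise \<longlonglongrightarrow> 0"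
  unfolding tail_noise_def[abs_def] by (rule suminf_exist_split2[OF summable_noise])

section \<open>The filtration and the one-step conditional law\<close>

lemma space_\<F> [simp]: "space (\<F> n) = space M"
  by (auto simp: history_def space_measure_of_conv)

lemma sets_\<F>: "sets (\<F> n) = sigma_sets (space M) {B i -` A \<inter> space M | i A. i \<in> {1..n}}"
  by (auto simp: history_def intro!: sets_measure_of)

lemma subalgebra_\<F>: "subalgebra M (\<F> n)"
  unfolding subalgebra_def
proof
  have "{B i -` A \<inter> space M | i A. i \<in> {1..n}} \<subseteq> events"
    using random_variable_B by (auto intro: measurable_sets)
  then show "sets (\<F> n) \<subseteq> events"
    unfolding sets_\<F> by (rule sets.sigma_sets_subset)
qed simp

lemma \<F>_mono: "m \<le> n \<Longrightarrow> sets (\<F> m) \<subseteq> sets (\<F> n)"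
  unfolding sets_\<F> by (rule sigma_sets_mono') force

lemma measurable_B_\<F>: "1 \<le> i \<Longrightarrow> i \<le> n \<Longrightarrow> B i \<in> \<F> n \<rightarrow>\<^sub>M count_space UNIV"
  by (rule measurableI) (auto simp: sets_\<F> intro!: sigma_sets.Basic)

lemma measurable_\<Theta>_\<F>: "k \<le> n \<Longrightarrow> \<Theta> k \<in> borel_measurable (\<F> n)"
proof -
  assume "k \<le> n"
  then have "(\<lambda>\<omega>. real (B i \<omega>)) \<in> borel_measurable (\<F> n)" if "i \<in> {1..k}" for i
    using that by (intro measurable_compose[OF measurable_B_\<F>]) auto
  then show ?thesis
    unfolding proportion_def[abs_def] first_bin_def by (simp add: borel_measurable_sum)
qed

lemma measurable_\<Theta>: "\<Theta> k \<in> borel_measurable M"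
  by (rule measurable_from_subalg[OF subalgebra_\<F> measurable_\<Theta>_\<F>[OF order_refl]])

sublocale \<F>: finite_measure_subalgebra M "\<F> n" for n
  by unfold_locales (rule subalgebra_\<F>)

abbreviation P :: "nat \<Rightarrow> 'a \<Rightarrow> real" where "P n \<omega> \<equiv> feedback \<alpha> (\<Theta> n \<omega>)"

text \<open>The binomial law gives \<open>{..\<sigma> (Suc n)}\<close> full mass, so the event has
  conditional probability 1 almost surely; integrating gives probability 1.\<close>

lemma AE_B_le: "AE \<omega> in M. \<forall>n. B (Suc n) \<omega> \<le> \<sigma> (Suc n)"
proof (subst AE_all_countable, rule allI)
  fix n
  let ?E = "B (Suc n) -` {..\<sigma> (Suc n)} \<inter> space M"
  have E: "?E \<in> events" using random_variable_B[of "Suc n"] by (auto intro: measurable_sets)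
  have "set_pmf (binomial_pmf (\<sigma> (Suc n)) (P n \<omega>)) \<subseteq> {..\<sigma> (Suc n)}" for \<omega>
    by (auto simp: set_pmf_binomial_eq feedback_nonneg feedback_le_1)
  then have "measure_pmf.prob (binomial_pmf (\<sigma> (Suc n)) (P n \<omega>)) {..\<sigma> (Suc n)} = 1" for \<omega>
    by (subst measure_pmf.prob_eq_1) (auto simp: AE_measure_pmf_iff)
  then have ce: "AE \<omega> in M. real_cond_exp M (\<F> n) (indicator ?E) \<omega> = 1"
    using conditional_law[of n "{..\<sigma> (Suc n)}"] by simp
  have "prob ?E = (\<integral>\<omega>. indicator ?E \<omega> \<partial>M)" using E by simp
  also have "\<dots> = (\<integral>\<omega>. real_cond_exp M (\<F> n) (indicator ?E) \<omega> \<partial>M)"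
    using E by (intro \<F>.real_cond_exp_int(2)[symmetric]) (simp add: less_top[symmetric])
  also have "\<dots> = (\<integral>\<omega>. 1 \<partial>M)" using ce by (intro integral_cong_AE) auto
  finally have "AE \<omega> in M. \<omega> \<in> ?E" using E by (simp add: prob_eq_1 prob_space)
  then show "AE \<omega> in M. B (Suc n) \<omega> \<le> \<sigma> (Suc n)" by auto
qed

lemma AE_\<Theta>_bounds: "AE \<omega> in M. \<forall>n. \<Theta> n \<omega> \<in> {0..1}"
  using AE_B_le
proof eventually_elim
  case (elim \<omega>)
  have "first_bin T0 B n \<omega> \<le> \<tau> n" for n
  proof (induction n)
    case (Suc n)
    then show ?case using elim[rule_format, of n] by (simp add: first_bin_def total_balls_def)
  qed (use initial in \<open>simp add: first_bin_def total_balls_def\<close>)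
  then show ?case using \<tau>_pos by (auto simp: proportion_def divide_le_eq_1)
qed

lemma \<Theta>_Suc:
  "\<Theta> (Suc n) \<omega> = \<Theta> n \<omega> + gain n * (P n \<omega> - \<Theta> n \<omega>)
    + (real (B (Suc n) \<omega>) - real (\<sigma> (Suc n)) * P n \<omega>) / \<tau> (Suc n)"
proof -
  define s t :: real where "s = real (\<sigma> (Suc n))" and "t = real (\<tau> (Suc n))"
  have t: "0 < t" "real (\<tau> n) = t - s" using \<tau>_pos[of "Suc n"] by (auto simp: t_def s_def \<tau>_Suc)
  have "real (first_bin T0 B n \<omega>) = (t - s) * \<Theta> n \<omega>"
    using \<tau>_pos[of n] t(2) by (simp add: proportion_def)
  then have "\<Theta> (Suc n) \<omega> = ((t - s) * \<Theta> n \<omega> + B (Suc n) \<omega>) / t"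
    by (simp add: proportion_def first_bin_def t_def)
  then show ?thesis
    unfolding gain_def s_def[symmetric] t_def[symmetric] using t(1) by (simp add: field_simps)
qed

text \<open>\<open>B (Suc n)\<close> almost surely takes one of finitely many values, so the
  integral splits over the events \<open>E b\<close>. There the second argument of \<open>G\<close>
  is frozen and \<open>G \<omega> b\<close> is known at time \<open>n\<close>, so the indicator of
  \<open>E b\<close> can be replaced by its conditional probability. Summing over \<open>b\<close>
  gives the binomial expectation.\<close>

lemma conditional_expectation_step:
  fixes G :: "'a \<Rightarrow> nat \<Rightarrow> real" and H :: "'a \<Rightarrow> real"
  assumes G: "\<And>b. (\<lambda>\<omega>. G \<omega> b) \<in> borel_measurable (\<F> n)"
    and H: "integrable M H"
    and bounded: "AE \<omega> in M. \<forall>b\<le>\<sigma> (Suc n). \<bar>G \<omega> b\<bar> \<le> C"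
    and le: "AE \<omega> in M. measure_pmf.expectation (binomial_pmf (\<sigma> (Suc n)) (P n \<omega>)) (G \<omega>) \<le> H \<omega>"
    and D: "D \<in> sets (\<F> n)"
  shows "(\<integral>\<omega>. indicator D \<omega> * G \<omega> (B (Suc n) \<omega>) \<partial>M) \<le> (\<integral>\<omega>. indicator D \<omega> * H \<omega> \<partial>M)"
proof -
  let ?S = "{..\<sigma> (Suc n)}"
  define E where "E b = B (Suc n) -` {b} \<inter> space M" for b
  have E [measurable]: "E b \<in> events" for b
    unfolding E_def using random_variable_B[of "Suc n"] by (auto intro: measurable_sets)
  have D_ev [measurable]: "D \<in> events" using D subalgebra_\<F>[of n] by (auto simp: subalgebra_def)
  have G_M [measurable]: "(\<lambda>\<omega>. G \<omega> b) \<in> borel_measurable M" for b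
    by (rule measurable_from_subalg[OF subalgebra_\<F> G])
  have DG: "(\<lambda>\<omega>. indicator D \<omega> * G \<omega> b) \<in> borel_measurable (\<F> n)" for b
    using D G by measurable
  have int: "integrable M (\<lambda>\<omega>. indicator D \<omega> * G \<omega> b * indicator (E b) \<omega>)" if "b \<in> ?S" for b
  proof (rule integrable_const_bound[where B=C])
    show "AE \<omega> in M. norm (indicator D \<omega> * G \<omega> b * indicator (E b) \<omega>) \<le> C"
      using bounded
    proof eventually_elim
      case (elim \<omega>)
      then have "\<bar>G \<omega> b\<bar> \<le> C" using that by simp
      then show ?case by (auto simp: indicator_def abs_mult)
    qed
  qed measurable
  note ce = \<F>.real_cond_exp_intg[OF int DG borel_measurable_indicator[OF E]]
  have "(\<integral>\<omega>. indicator D \<omega> * G \<omega> (B (Suc n) \<omega>) \<partial>M)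
      = (\<integral>\<omega>. (\<Sum>b\<in>?S. indicator D \<omega> * G \<omega> b * indicator (E b) \<omega>) \<partial>M)"
  proof (rule integral_cong_AE)
    show "(\<lambda>\<omega>. indicator D \<omega> * G \<omega> (B (Suc n) \<omega>)) \<in> borel_measurable M"
      using measurable_compose_countable[OF G_M random_variable_B[of "Suc n"]] by measurable
    show "AE \<omega> in M. indicator D \<omega> * G \<omega> (B (Suc n) \<omega>)
        = (\<Sum>b\<in>?S. indicator D \<omega> * G \<omega> b * indicator (E b) \<omega>)"
      using AE_B_le AE_space
    proof eventually_elim
      case (elim \<omega>)
      then have "(\<Sum>b\<in>?S. indicator D \<omega> * G \<omega> b * indicator (E b) \<omega>)
          = (\<Sum>b\<in>?S. if b = B (Suc n) \<omega> then indicator D \<omega> * G \<omega> b else 0)"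
        by (intro sum.cong) (auto simp: E_def indicator_def)
      then show ?case using elim by simp
    qed
  qed measurable
  also have "\<dots> = (\<Sum>b\<in>?S. \<integral>\<omega>. indicator D \<omega> * G \<omega> b * indicator (E b) \<omega> \<partial>M)"
    by (rule Bochner_Integration.integral_sum[OF int])
  also have "\<dots> = (\<Sum>b\<in>?S. \<integral>\<omega>. indicator D \<omega> * G \<omega> b * real_cond_exp M (\<F> n) (indicator (E b)) \<omega> \<partial>M)"
    by (intro sum.cong refl ce(2)[symmetric])
  also have "\<dots> = (\<integral>\<omega>. (\<Sum>b\<in>?S. indicator D \<omega> * G \<omega> b * real_cond_exp M (\<F> n) (indicator (E b)) \<omega>) \<partial>M)"
    by (rule Bochner_Integration.integral_sum[OF ce(1), symmetric])
  also have "\<dots> \<le> (\<integral>\<omega>. indicator D \<omega> * H \<omega> \<partial>M)"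
  proof (rule integral_mono_AE)
    \<comment> \<open>The conditional law holds for each set of values outside its own null set;
      countably many singletons share one null set.\<close>
    have "AE \<omega> in M. \<forall>b. real_cond_exp M (\<F> n) (indicator (E b)) \<omega>
        = measure_pmf.prob (binomial_pmf (\<sigma> (Suc n)) (P n \<omega>)) {b}"
      unfolding E_def by (subst AE_all_countable) (use conditional_law in blast)
    then show "AE \<omega> in M. (\<Sum>b\<in>?S. indicator D \<omega> * G \<omega> b * real_cond_exp M (\<F> n) (indicator (E b)) \<omega>)
        \<le> indicator D \<omega> * H \<omega>"
      using le
    proof eventually_elim
      case (elim \<omega>)
      have "measure_pmf.expectation (binomial_pmf (\<sigma> (Suc n)) (P n \<omega>)) (G \<omega>)
          = (\<Sum>b\<in>?S. G \<omega> b * pmf (binomial_pmf (\<sigma> (Suc n)) (P n \<omega>)) b)"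
        by (rule integral_measure_pmf_real)
          (auto simp: set_pmf_binomial_eq feedback_nonneg feedback_le_1 split: if_splits)
      then have "(\<Sum>b\<in>?S. indicator D \<omega> * G \<omega> b * real_cond_exp M (\<F> n) (indicator (E b)) \<omega>)
          = indicator D \<omega> * measure_pmf.expectation (binomial_pmf (\<sigma> (Suc n)) (P n \<omega>)) (G \<omega>)"
        using elim(1) by (simp add: sum_distrib_left mult.assoc measure_pmf_single)
      then show ?case using elim(2) by (auto simp: indicator_def)
    qed
    show "integrable M (\<lambda>\<omega>. indicator D \<omega> * H \<omega>)"
      using integrable_mult_indicator[OF D_ev H] by simp
  qed (intro Bochner_Integration.integrable_sum ce(1))
  finally show ?thesis .
qed

section \<open>Doob decomposition of the proportion and convergence of its martingale part\<close>

definition martingale_part :: "nat \<Rightarrow> 'a \<Rightarrow> real" where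
  "martingale_part n \<omega> = \<Theta> n \<omega> - (\<Sum>k<n. gain k * (P k \<omega> - \<Theta> k \<omega>))"

lemma martingale_part_Suc:
  "martingale_part (Suc n) \<omega> = martingale_part n \<omega>
    + (real (B (Suc n) \<omega>) - real (\<sigma> (Suc n)) * P n \<omega>) / \<tau> (Suc n)"
  by (simp add: martingale_part_def \<Theta>_Suc)

lemma measurable_P_\<F>: "k \<le> n \<Longrightarrow> P k \<in> borel_measurable (\<F> n)"
  unfolding feedback_def using measurable_\<Theta>_\<F> by measurable

lemma measurable_martingale_part_\<F>: "k \<le> n \<Longrightarrow> martingale_part k \<in> borel_measurable (\<F> n)"
  unfolding martingale_part_def[abs_def]
  by (intro borel_measurable_diff borel_measurable_sum borel_measurable_times
      measurable_\<Theta>_\<F> measurable_P_\<F> borel_measurable_const) auto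

lemma martingale_part_bound:
  assumes "\<And>n. \<Theta> n \<omega> \<in> {0..1}"
  shows "\<bar>martingale_part n \<omega>\<bar> \<le> 1 + real n"
proof -
  have "\<bar>gain k * (P k \<omega> - \<Theta> k \<omega>)\<bar> \<le> 1" for k
  proof -
    have "\<bar>P k \<omega> - \<Theta> k \<omega>\<bar> \<le> 1"
      using assms[of k] feedback_nonneg[of \<alpha> "\<Theta> k \<omega>"] feedback_le_1[of \<alpha> "\<Theta> k \<omega>"] by auto
    then show ?thesis using gain_bounds[of k] by (simp add: abs_mult mult_le_one)
  qed
  then have "\<bar>\<Sum>k<n. gain k * (P k \<omega> - \<Theta> k \<omega>)\<bar> \<le> (\<Sum>k<n. 1)"
    by (intro order_trans[OF sum_abs] sum_mono)
  then show ?thesis using assms[of n] by (auto simp: martingale_part_def)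
qed

lemma increment_bound:
  assumes "b \<le> \<sigma> (Suc n)"
  shows "\<bar>(real b - real (\<sigma> (Suc n)) * P n \<omega>) / \<tau> (Suc n)\<bar> \<le> 1"
proof -
  have "0 \<le> real (\<sigma> (Suc n)) * P n \<omega>" "real (\<sigma> (Suc n)) * P n \<omega> \<le> real (\<sigma> (Suc n))"
    by (simp_all add: feedback_nonneg feedback_le_1 mult_left_le)
  then show ?thesis using assms \<tau>_pos[of n] by (simp add: abs_divide divide_le_eq \<tau>_Suc)
qed

text \<open>In step \<open>k\<close> the conditional mean of the squared deviation grows by at most
  \<open>noise k / 4\<close>, exactly what \<open>tail_noise k / 4\<close> loses. Their sum
  \<open>Z\<close> is a nonnegative supermartingale started at \<open>tail_noise n / 4\<close>, and
  the maximal inequality gives a Kolmogorov-type bound over an infinite horizon.\<close>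

lemma prob_martingale_part_deviates:
  assumes \<eta>: "0 < \<eta>"
  shows "\<eta> ^ 2 * prob {\<omega>\<in>space M. \<exists>k\<ge>n. \<eta> \<le> \<bar>martingale_part k \<omega> - martingale_part n \<omega>\<bar>}
    \<le> tail_noise n / 4"
proof -
  define Z where "Z k \<omega> = (martingale_part k \<omega> - martingale_part n \<omega>) ^ 2 + tail_noise k / 4" for k \<omega>
  have Z_meas: "Z k \<in> borel_measurable (\<F> k)" if "n \<le> k" for k
    unfolding Z_def[abs_def] using that
    by (intro borel_measurable_add borel_measurable_power borel_measurable_diff
        measurable_martingale_part_\<F> borel_measurable_const) auto
  have diff_bound: "\<bar>martingale_part k \<omega> - martingale_part n \<omega>\<bar> \<le> 2 + real k + real n"
    if "\<forall>n. \<Theta> n \<omega> \<in> {0..1}" for k \<omega>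
    using martingale_part_bound[of \<omega> k] martingale_part_bound[of \<omega> n] that by auto
  have Z_int: "integrable M (Z k)" if "n \<le> k" for k
  proof (rule integrable_const_bound[where B="(2 + real k + real n) ^ 2 + tail_noise k / 4"])
    show "AE \<omega> in M. norm (Z k \<omega>) \<le> (2 + real k + real n) ^ 2 + tail_noise k / 4"
      using AE_\<Theta>_bounds
    proof eventually_elim
      case (elim \<omega>)
      have "(martingale_part k \<omega> - martingale_part n \<omega>) ^ 2 \<le> (2 + real k + real n) ^ 2"
        using power_mono[OF diff_bound[OF elim, of k], of 2] by simp
      then show ?case using tail_noise_nonneg[of k] by (simp add: Z_def)
    qed
  qed (rule measurable_from_subalg[OF subalgebra_\<F> Z_meas[OF that]])
  have "\<eta> ^ 2 * prob {\<omega>\<in>space M. \<exists>k\<ge>n. \<eta> ^ 2 \<le> Z k \<omega>} \<le> (\<integral>\<omega>. indicator (space M) \<omega> * Z n \<omega> \<partial>M)"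
  proof (rule prob_le_supermartingale[OF subalgebra_\<F> \<F>_mono Z_meas Z_int])
    show "0 \<le> Z k \<omega>" for k \<omega> using tail_noise_nonneg[of k] by (simp add: Z_def)
  next
    fix k D assume k: "n \<le> k" and D: "D \<in> sets (\<F> k)"
    define G where "G \<omega> b = (martingale_part k \<omega> - martingale_part n \<omega>
        + (real b - real (\<sigma> (Suc k)) * P k \<omega>) / \<tau> (Suc k)) ^ 2 + tail_noise (Suc k) / 4" for \<omega> b
    have "(\<integral>\<omega>. indicator D \<omega> * G \<omega> (B (Suc k) \<omega>) \<partial>M) \<le> (\<integral>\<omega>. indicator D \<omega> * Z k \<omega> \<partial>M)"
    proof (rule conditional_expectation_step[OF _ Z_int[OF k] _ _ D])
      show "(\<lambda>\<omega>. G \<omega> b) \<in> borel_measurable (\<F> k)" for b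
        unfolding G_def[abs_def] using k
        by (intro borel_measurable_add borel_measurable_power borel_measurable_diff borel_measurable_times
            borel_measurable_divide measurable_martingale_part_\<F> measurable_P_\<F> borel_measurable_const) auto
      show "AE \<omega> in M. \<forall>b\<le>\<sigma> (Suc k). \<bar>G \<omega> b\<bar> \<le> (3 + real k + real n) ^ 2 + tail_noise (Suc k) / 4"
        using AE_\<Theta>_bounds
      proof (eventually_elim, intro allI impI)
        fix \<omega> b assume \<omega>: "\<forall>n. \<Theta> n \<omega> \<in> {0..1}" and b: "b \<le> \<sigma> (Suc k)"
        have "\<bar>martingale_part k \<omega> - martingale_part n \<omega>
            + (real b - real (\<sigma> (Suc k)) * P k \<omega>) / \<tau> (Suc k)\<bar> \<le> 3 + real k + real n"
          using diff_bound[OF \<omega>, of k] increment_bound[OF b, of \<omega>] by linarith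
        from power_mono[OF this, of 2]
        show "\<bar>G \<omega> b\<bar> \<le> (3 + real k + real n) ^ 2 + tail_noise (Suc k) / 4"
          using tail_noise_nonneg[of "Suc k"] by (simp add: G_def)
      qed
      show "AE \<omega> in M. measure_pmf.expectation (binomial_pmf (\<sigma> (Suc k)) (P k \<omega>)) (G \<omega>) \<le> Z k \<omega>"
      proof (rule AE_I2)
        fix \<omega>
        define a t where "a = martingale_part k \<omega> - martingale_part n \<omega>" and "t = real (\<tau> (Suc k))"
        have "G \<omega> = (\<lambda>b. (a ^ 2 + tail_noise (Suc k) / 4) + 2 * a / t * (real b - real (\<sigma> (Suc k)) * P k \<omega>)
            + 1 / t ^ 2 * (real b - real (\<sigma> (Suc k)) * P k \<omega>) ^ 2
            + 0 * (real b - real (\<sigma> (Suc k)) * P k \<omega>) ^ 4)"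
          by (rule ext) (simp add: G_def a_def[symmetric] t_def[symmetric] power2_sum power_divide)
        then have "measure_pmf.expectation (binomial_pmf (\<sigma> (Suc k)) (P k \<omega>)) (G \<omega>)
            = a ^ 2 + tail_noise (Suc k) / 4 + P k \<omega> * (1 - P k \<omega>) * noise k"
          by (simp only: expectation_binomial_quartic[OF feedback_nonneg feedback_le_1])
            (simp add: noise_def t_def)
        also have "P k \<omega> * (1 - P k \<omega>) * noise k \<le> 1 / 4 * noise k"
          using noise_pos[of k] by (intro mult_right_mono mult_one_minus_le) simp
        finally show "measure_pmf.expectation (binomial_pmf (\<sigma> (Suc k)) (P k \<omega>)) (G \<omega>) \<le> Z k \<omega>"
          by (simp add: Z_def a_def tail_noise_Suc[of k] add_divide_distrib)
      qed
    qed
    also have "(\<lambda>\<omega>. G \<omega> (B (Suc k) \<omega>)) = Z (Suc k)"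
      by (rule ext) (simp add: G_def Z_def martingale_part_Suc algebra_simps)
    finally show "(\<integral>\<omega>. indicator D \<omega> * Z (Suc k) \<omega> \<partial>M) \<le> (\<integral>\<omega>. indicator D \<omega> * Z k \<omega> \<partial>M)"
      by (metis (no_types))
  qed (use \<eta> sets.top[of "\<F> n"] in auto)
  also have "\<dots> = (\<integral>\<omega>. tail_noise n / 4 \<partial>M)"
    by (intro Bochner_Integration.integral_cong) (auto simp: Z_def)
  also have "\<dots> = tail_noise n / 4" by (simp add: prob_space)
  finally have main: "\<eta> ^ 2 * prob {\<omega>\<in>space M. \<exists>k\<ge>n. \<eta> ^ 2 \<le> Z k \<omega>} \<le> tail_noise n / 4" .
  have "prob {\<omega>\<in>space M. \<exists>k\<ge>n. \<eta> \<le> \<bar>martingale_part k \<omega> - martingale_part n \<omega>\<bar>}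
      \<le> prob {\<omega>\<in>space M. \<exists>k\<ge>n. \<eta> ^ 2 \<le> Z k \<omega>}"
  proof (rule finite_measure_mono)
    show "{\<omega>\<in>space M. \<exists>k\<ge>n. \<eta> \<le> \<bar>martingale_part k \<omega> - martingale_part n \<omega>\<bar>}
        \<subseteq> {\<omega>\<in>space M. \<exists>k\<ge>n. \<eta> ^ 2 \<le> Z k \<omega>}"
    proof
      fix \<omega> assume "\<omega> \<in> {\<omega>\<in>space M. \<exists>k\<ge>n. \<eta> \<le> \<bar>martingale_part k \<omega> - martingale_part n \<omega>\<bar>}"
      then obtain k where *: "\<omega> \<in> space M" "n \<le> k" "\<eta> \<le> \<bar>martingale_part k \<omega> - martingale_part n \<omega>\<bar>" by blast
      have "\<eta> ^ 2 \<le> Z k \<omega>"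
        using power_mono[OF *(3), of 2] \<eta> tail_noise_nonneg[of k] by (simp add: Z_def)
      then show "\<omega> \<in> {\<omega>\<in>space M. \<exists>k\<ge>n. \<eta> ^ 2 \<le> Z k \<omega>}" using * by blast
    qed
    have "{\<omega>\<in>space M. \<exists>k\<ge>n. \<eta> ^ 2 \<le> Z k \<omega>} = (\<Union>k\<in>{n..}. {\<omega>\<in>space M. \<eta> ^ 2 \<le> Z k \<omega>})" by auto
    also have "\<dots> \<in> events"
      using borel_measurable_le[OF borel_measurable_const measurable_from_subalg[OF subalgebra_\<F> Z_meas]]
      by (intro sets.countable_UN') auto
    finally show "{\<omega>\<in>space M. \<exists>k\<ge>n. \<eta> ^ 2 \<le> Z k \<omega>} \<in> events" .
  qed
  then show ?thesis by (rule order_trans[OF mult_left_mono main]) simp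
qed

text \<open>Failure of the Cauchy criterion forces, for some \<open>\<eta>\<close>, a later
  deviation by \<open>\<eta>\<close> from every time \<open>n\<close>. By the deviation bound this
  has probability at most \<open>tail_noise n / 4 / \<eta> ^ 2\<close> for every \<open>n\<close>,
  hence 0. The countably many scales \<open>1 / Suc i\<close> suffice.\<close>

lemma AE_convergent_martingale_part: "AE \<omega> in M. convergent (\<lambda>n. martingale_part n \<omega>)"
proof -
  have [measurable]: "martingale_part k \<in> borel_measurable M" for k
    by (rule measurable_from_subalg[OF subalgebra_\<F> measurable_martingale_part_\<F>[OF order_refl]])
  have "AE \<omega> in M. \<exists>n. \<forall>k\<ge>n. \<bar>martingale_part k \<omega> - martingale_part n \<omega>\<bar> < \<eta>" if \<eta>: "0 < \<eta>" for \<eta>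
  proof -
    let ?bad = "\<lambda>n. {\<omega>\<in>space M. \<exists>k\<ge>n. \<eta> \<le> \<bar>martingale_part k \<omega> - martingale_part n \<omega>\<bar>}"
    have bad [measurable]: "?bad n \<in> events" for n by measurable
    have "prob (\<Inter>n. ?bad n) \<le> tail_noise n / 4 / \<eta> ^ 2" for n
    proof -
      have "prob (\<Inter>n. ?bad n) \<le> prob (?bad n)" by (intro finite_measure_mono bad) auto
      also have "\<dots> \<le> tail_noise n / 4 / \<eta> ^ 2"
        using prob_martingale_part_deviates[OF \<eta>, of n] \<eta> by (simp add: field_simps)
      finally show ?thesis .
    qed
    moreover have "(\<lambda>n. tail_noise n / 4 / \<eta> ^ 2) \<longlonglongrightarrow> 0 / 4 / \<eta> ^ 2"
      using \<eta> by (intro tendsto_divide tail_noise_tendsto_0 tendsto_const) auto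
    ultimately have "prob (\<Inter>n. ?bad n) \<le> 0"
      by (intro LIMSEQ_le_const[of "\<lambda>n. tail_noise n / 4 / \<eta> ^ 2"]) auto
    then have "prob (\<Inter>n. ?bad n) = 0" by (simp add: measure_le_0_iff)
    then have "AE \<omega> in M. \<omega> \<notin> (\<Inter>n. ?bad n)" by (subst (asm) prob_eq_0) auto
    then show ?thesis using AE_space
    proof eventually_elim
      case (elim \<omega>)
      then obtain n where "\<And>k. k \<ge> n \<Longrightarrow> \<not> \<eta> \<le> \<bar>martingale_part k \<omega> - martingale_part n \<omega>\<bar>" by blast
      then show ?case by (meson not_le)
    qed
  qed
  then have "AE \<omega> in M. \<forall>i. \<exists>n. \<forall>k\<ge>n. \<bar>martingale_part k \<omega> - martingale_part n \<omega>\<bar> < 1 / Suc i"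
    by (subst AE_all_countable) simp
  then show ?thesis
  proof eventually_elim
    case (elim \<omega>)
    have "Cauchy (\<lambda>n. martingale_part n \<omega>)"
    proof (rule metric_CauchyI)
      fix e :: real assume "0 < e"
      then obtain i where i: "1 / Suc i < e / 2" using nat_approx_posE[of "e / 2"] by auto
      obtain n where n: "\<And>k. k \<ge> n \<Longrightarrow> \<bar>martingale_part k \<omega> - martingale_part n \<omega>\<bar> < 1 / Suc i"
        using elim by blast
      have "dist (martingale_part k \<omega>) (martingale_part l \<omega>) < e" if "k \<ge> n" "l \<ge> n" for k l
        using n[OF that(1)] n[OF that(2)] i unfolding dist_real_def by linarith
      then show "\<exists>n. \<forall>k\<ge>n. \<forall>l\<ge>n. dist (martingale_part k \<omega>) (martingale_part l \<omega>) < e" by blast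
    qed
    then show ?case by (simp add: Cauchy_convergent_iff)
  qed
qed

lemma AE_limit_zero_half_one:
  assumes "1 < \<alpha>"
  shows "AE \<omega> in M. (\<lambda>n. \<Theta> n \<omega>) \<longlonglongrightarrow> 0 \<or> (\<lambda>n. \<Theta> n \<omega>) \<longlonglongrightarrow> 1 / 2 \<or> (\<lambda>n. \<Theta> n \<omega>) \<longlonglongrightarrow> 1"
  using AE_\<Theta>_bounds AE_convergent_martingale_part
proof eventually_elim
  case (elim \<omega>)
  show ?case
    by (rule feedback_drift_limits[OF assms _ _ elim(2) gain_bounds(1) not_summable_gain])
      (use elim(1) in \<open>auto simp: martingale_part_def\<close>)
qed

section \<open>The unstable limit has probability zero\<close>

text \<open>Above 1/2 \<open>feedback\<close> is at least the identity, and reflection reverses this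
  below, so the drift never opposes the sign of \<open>\<theta> - 1 / 2\<close>. The conclusions are
  the hypotheses on \<open>x\<close> and \<open>y\<close> in the one-step bound for the Chebyshev
  part.\<close>

lemma drift_away_from_half:
  assumes \<alpha>: "1 < \<alpha>" and \<theta>: "\<theta> \<in> {0..1}"
  shows "\<bar>\<theta> - 1 / 2\<bar> \<le> \<bar>\<theta> - 1 / 2 + gain n * (feedback \<alpha> \<theta> - \<theta>)\<bar>"
    and "0 \<le> (\<theta> - 1 / 2) * (\<theta> - 1 / 2 + gain n * (feedback \<alpha> \<theta> - \<theta>))"
proof -
  consider "1 / 2 \<le> \<theta>" "\<theta> \<le> feedback \<alpha> \<theta>" | "\<theta> \<le> 1 / 2" "feedback \<alpha> \<theta> \<le> \<theta>"
    using feedback_ge[OF \<alpha>, of \<theta>] feedback_ge[OF \<alpha>, of "1 - \<theta>"] feedback_reflect[of \<theta> \<alpha>] \<theta> by fastforce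
  then have "\<bar>\<theta> - 1 / 2\<bar> \<le> \<bar>\<theta> - 1 / 2 + gain n * (feedback \<alpha> \<theta> - \<theta>)\<bar>
    \<and> 0 \<le> (\<theta> - 1 / 2) * (\<theta> - 1 / 2 + gain n * (feedback \<alpha> \<theta> - \<theta>))"
  proof cases
    case 1
    then have "0 \<le> gain n * (feedback \<alpha> \<theta> - \<theta>)" using gain_bounds by simp
    with 1 show ?thesis by (simp add: mult_nonneg_nonneg)
  next
    case 2
    then have "gain n * (feedback \<alpha> \<theta> - \<theta>) \<le> 0" using gain_bounds by (simp add: mult_nonneg_nonpos)
    with 2 show ?thesis by (simp add: mult_nonpos_nonpos)
  qed
  then show "\<bar>\<theta> - 1 / 2\<bar> \<le> \<bar>\<theta> - 1 / 2 + gain n * (feedback \<alpha> \<theta> - \<theta>)\<bar>"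
    and "0 \<le> (\<theta> - 1 / 2) * (\<theta> - 1 / 2 + gain n * (feedback \<alpha> \<theta> - \<theta>))" by auto
qed

text \<open>The conditional mean after the step, centred at 1/2, is a convex combination of
  \<open>\<theta> - 1 / 2\<close> and \<open>feedback \<alpha> \<theta> - 1 / 2\<close> with weight
  \<open>gain n\<close>, so the distance grows at most by the factor \<open>L\<close>, however large
  the step.\<close>

lemma drift_le_lipschitz:
  assumes "1 \<le> L" "\<bar>feedback \<alpha> \<theta> - 1 / 2\<bar> \<le> L * \<bar>\<theta> - 1 / 2\<bar>"
  shows "\<bar>\<theta> - 1 / 2 + gain n * (feedback \<alpha> \<theta> - \<theta>)\<bar> \<le> L * \<bar>\<theta> - 1 / 2\<bar>"
proof -
  have "\<theta> - 1 / 2 + gain n * (feedback \<alpha> \<theta> - \<theta>)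
      = (1 - gain n) * (\<theta> - 1 / 2) + gain n * (feedback \<alpha> \<theta> - 1 / 2)" by (simp add: algebra_simps)
  also have "\<bar>\<dots>\<bar> \<le> (1 - gain n) * \<bar>\<theta> - 1 / 2\<bar> + gain n * \<bar>feedback \<alpha> \<theta> - 1 / 2\<bar>"
    using gain_bounds[of n] by (intro order_trans[OF abs_triangle_ineq]) (simp add: abs_mult)
  also have "\<dots> \<le> (1 - gain n) * (L * \<bar>\<theta> - 1 / 2\<bar>) + gain n * (L * \<bar>\<theta> - 1 / 2\<bar>)"
    using assms gain_bounds[of n] mult_right_mono[OF assms(1), of "\<bar>\<theta> - 1 / 2\<bar>"]
    by (intro add_mono mult_left_mono) auto
  finally show ?thesis by (simp add: algebra_simps)
qed

text \<open>The slope bound is asked only within distance sqrt V, where the escape part is used. The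
  Chebyshev part rests on the drift pointing away from 1/2, which holds on all of [0, 1].\<close>

lemma return_potential_supersolution:
  fixes L V :: real
  defines "\<kappa> \<equiv> 1 / (64 * L ^ 2)"
  assumes \<alpha>: "1 < \<alpha>" and \<theta>: "\<theta> \<in> {0..1}" and L: "1 \<le> L"
    and lip: "(\<theta> - 1 / 2) ^ 2 \<le> V \<Longrightarrow> \<bar>feedback \<alpha> \<theta> - 1 / 2\<bar> \<le> L * \<bar>\<theta> - 1 / 2\<bar>"
    and V: "tail_noise k \<le> V" "L ^ 2 * V \<le> 1 / 16"
  shows "measure_pmf.expectation (binomial_pmf (\<sigma> (Suc k)) (feedback \<alpha> \<theta>))
      (\<lambda>b. return_potential \<kappa> V (tail_noise (Suc k)) (\<theta> - 1 / 2 + gain k * (feedback \<alpha> \<theta> - \<theta>)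
        + (real b - real (\<sigma> (Suc k)) * feedback \<alpha> \<theta>) / \<tau> (Suc k)))
    \<le> return_potential \<kappa> V (tail_noise k) (\<theta> - 1 / 2)"
proof -
  define p x y where "p = feedback \<alpha> \<theta>" and "x = \<theta> - 1 / 2" and "y = x + gain k * (p - \<theta>)"
  define n t where "n = \<sigma> (Suc k)" and "t = real (\<tau> (Suc k))"
  define X where "X b = y + (real b - real n * p) / t" for b :: nat
  let ?E = "measure_pmf.expectation (binomial_pmf n p)"
  have p: "0 \<le> p" "p \<le> 1" by (simp_all add: p_def feedback_nonneg feedback_le_1)
  have V_pos: "0 < V" using tail_noise_pos[of k] V by simp
  have noise: "noise k = n / t ^ 2" by (simp add: noise_def n_def t_def)
  have L2: "1 \<le> L ^ 2" using L by (simp add: one_le_power)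
  then have \<kappa>: "0 \<le> \<kappa>" "\<kappa> \<le> 1" by (auto simp: \<kappa>_def divide_le_eq)
  note I = integrable_binomial_pmf[OF p]
  have far: "?E (\<lambda>b. return_potential \<kappa> V (tail_noise (Suc k)) (X b))
    \<le> ((max 0 (sqrt V - \<bar>x\<bar>)) ^ 2 + tail_noise k / 4) / V"
  proof -
    have "?E (\<lambda>b. return_potential \<kappa> V (tail_noise (Suc k)) (X b))
        \<le> ?E (\<lambda>b. (max 0 (sqrt V - \<bar>X b\<bar>)) ^ 2 / V + tail_noise (Suc k) / 4 / V)"
      by (intro integral_mono I) (simp add: return_potential_def add_divide_distrib)
    also have "\<dots> = ?E (\<lambda>b. (max 0 (sqrt V - \<bar>X b\<bar>)) ^ 2) / V + tail_noise (Suc k) / 4 / V"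
      by (simp add: I)
    also have "\<dots> \<le> ((max 0 (sqrt V - \<bar>x\<bar>)) ^ 2 + p * (1 - p) * noise k) / V + tail_noise (Suc k) / 4 / V"
      using V_pos drift_away_from_half[OF \<alpha> \<theta>, of k] p unfolding X_def noise
      by (intro add_right_mono divide_right_mono expectation_hitting_potential_le)
        (auto simp: x_def y_def p_def)
    also have "\<dots> \<le> ((max 0 (sqrt V - \<bar>x\<bar>)) ^ 2 + 1 / 4 * noise k) / V + tail_noise (Suc k) / 4 / V"
      using V_pos noise_pos[of k]
      by (intro add_right_mono divide_right_mono add_left_mono mult_right_mono mult_one_minus_le) auto
    also have "\<dots> = ((max 0 (sqrt V - \<bar>x\<bar>)) ^ 2 + tail_noise k / 4) / V"
      by (simp add: tail_noise_Suc[of k] add_divide_distrib)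
    finally show ?thesis .
  qed
  have "?E (\<lambda>b. return_potential \<kappa> V (tail_noise (Suc k)) (X b)) \<le> return_potential \<kappa> V (tail_noise k) x"
  proof (cases "x ^ 2 \<le> V")
    case False
    then show ?thesis using far return_potential_far(1)[OF V_pos \<kappa> V(1), of x] by simp
  next
    case True
    have lip': "\<bar>p - 1 / 2\<bar> \<le> L * \<bar>x\<bar>" using lip True by (simp add: x_def p_def)
    have y_le: "\<bar>y\<bar> \<le> L * \<bar>x\<bar>"
      using drift_le_lipschitz[OF L, of \<theta> k] lip' by (simp add: x_def y_def p_def)
    have sq: "(L * \<bar>x\<bar>) ^ 2 \<le> L ^ 2 * V" using True by (simp add: power_mult_distrib mult_left_mono)
    have y: "y ^ 2 \<le> L ^ 2 * V" using power_mono[OF y_le, of 2] sq by simp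
    have xy: "x ^ 2 \<le> y ^ 2"
      using drift_away_from_half(1)[OF \<alpha> \<theta>, of k] by (simp add: x_def y_def p_def abs_le_square_iff)
    \<comment> \<open>The bound on \<open>L ^ 2 * V\<close> enters here: p (1 - p) = 1/4 - (p -
      1/2)^2 keeps the variance of the step comparable to its maximum.\<close>
    have "(p - 1 / 2) ^ 2 \<le> 1 / 16" using power_mono[OF lip', of 2] sq V by simp
    then have pq: "3 / 16 \<le> p * (1 - p)" by (simp add: power2_eq_square algebra_simps)
    have "noise k \<le> V" using noise_le_tail_noise[of k k] V by simp
    have "?E (\<lambda>b. return_potential \<kappa> V (tail_noise (Suc k)) (X b))
        \<le> ?E (\<lambda>b. 1 - \<kappa> * X b ^ 2 / V + \<kappa> ^ 2 * X b ^ 4 / V ^ 2 - \<kappa> / 8 * (tail_noise k - n / t ^ 2) / V)"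
      using tail_noise_Suc[of k] by (intro integral_mono I) (simp add: return_potential_def noise)
    also have "\<dots> \<le> 1 - \<kappa> * x ^ 2 / V + \<kappa> ^ 2 * x ^ 4 / V ^ 2 - \<kappa> / 8 * tail_noise k / V"
      unfolding X_def \<kappa>_def using p pq L True y xy \<open>noise k \<le> V\<close> \<sigma>_Suc_pos[of k] \<tau>_pos[of "Suc k"]
      by (intro expectation_escape_potential_le) (auto simp: noise n_def t_def)
    finally show ?thesis using far by (simp add: return_potential_def)
  qed
  then show ?thesis by (simp add: X_def x_def y_def p_def n_def t_def)
qed

lemma prob_limit_half_zero:
  assumes \<alpha>: "1 < \<alpha>"
  shows "prob {\<omega>\<in>space M. (\<lambda>n. \<Theta> n \<omega>) \<longlonglongrightarrow> 1 / 2} = 0" (is "prob ?A = 0")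
proof -
  obtain L \<delta> :: real where L: "1 \<le> L" and \<delta>: "0 < \<delta>"
    and lip: "\<And>\<theta>. \<bar>\<theta> - 1 / 2\<bar> < \<delta> \<Longrightarrow> \<bar>feedback \<alpha> \<theta> - 1 / 2\<bar> \<le> L * \<bar>\<theta> - 1 / 2\<bar>"
    by (rule feedback_lipschitz_at_half[of \<alpha>]) (rule that)
  define \<kappa> where "\<kappa> = 1 / (64 * L ^ 2)"
  \<comment> \<open>A level strictly between the bound \<open>1 - \<kappa> / 8\<close> at the
    reference time and the limit 1 along paths tending to 1/2; hence \<open>q < 1\<close>. Both
    constants depend on \<open>L\<close> alone and not on the reference time.\<close>
  define c where "c = 1 - \<kappa> / 16"
  define q where "q = (1 - \<kappa> / 8) / c"
  have L2: "1 \<le> L ^ 2" using L by (simp add: one_le_power)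
  then have \<kappa>: "0 < \<kappa>" "\<kappa> \<le> 1" by (auto simp: \<kappa>_def divide_le_eq)
  then have c: "0 < c" "c < 1" and q: "0 \<le> q" "q < 1" by (auto simp: c_def q_def)
  \<comment> \<open>The first bound makes sqrt V less than \<open>\<delta>\<close>, so that the
    slope bound holds up to that distance; the second keeps the success probability within 1/4 of
    1/2 there.\<close>
  have "eventually (\<lambda>n. tail_noise n < min (\<delta> ^ 2) (1 / (16 * L ^ 2))) sequentially"
    using \<delta> L2 by (intro order_tendstoD(2)[OF tail_noise_tendsto_0]) (auto simp: min_def)
  then obtain N where N: "\<And>n. n \<ge> N \<Longrightarrow> tail_noise n < min (\<delta> ^ 2) (1 / (16 * L ^ 2))"
    by (auto simp: eventually_sequentially)
  show ?thesis
  proof (rule prob_zero_if_conditionally_bounded[OF subalgebra_\<F> \<F>_mono _ q])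
    let ?U = "\<Union>n. sets (\<F> n)"
    have sub: "?U \<subseteq> Pow (space M)"
      using sets.sets_into_space by fastforce
    \<comment> \<open>The zero-one law requires the limit event to lie in the sigma-algebra
      generated by all histories, not merely in \<open>events\<close>.\<close>
    have "\<Theta> k \<in> borel_measurable (sigma (space M) ?U)" for k
      using measurable_\<Theta>_\<F>[OF order_refl, of k] sub
      by (intro measurable_mono[of borel borel "\<F> k" "sigma (space M) ?U", THEN subsetD])
        (auto simp: space_measure_of_conv sets_measure_of)
    then have "Measurable.pred (sigma (space M) ?U) (\<lambda>\<omega>. (\<lambda>n. \<Theta> n \<omega>) \<longlonglongrightarrow> 1 / 2)"
      by measurable
    then show "?A \<in> sigma_sets (space M) ?U"
      using sub by (simp add: pred_def space_measure_of_conv sets_measure_of)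
  next
    fix n D assume n: "N \<le> n" and D: "D \<in> sets (\<F> n)"
    define V where "V = tail_noise n"
    have "0 < V" "V < \<delta> ^ 2" "V < 1 / (16 * L ^ 2)"
      using N[OF n] tail_noise_pos[of n] by (auto simp: V_def)
    moreover from this have "L ^ 2 * V \<le> L ^ 2 * (1 / (16 * L ^ 2))" by (intro mult_left_mono) auto
    ultimately have V: "0 < V" "V < \<delta> ^ 2" "L ^ 2 * V \<le> 1 / 16" using L by auto
    define Z where "Z k \<omega> = (if n \<le> k then return_potential \<kappa> V (tail_noise k) (\<Theta> k \<omega> - 1 / 2) else 0)" for k \<omega>
    have w: "0 \<le> tail_noise k" "n \<le> k \<Longrightarrow> tail_noise k \<le> V" for k
      using tail_noise_nonneg tail_noise_antimono by (auto simp: V_def)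
    have Z_nonneg: "0 \<le> Z k \<omega>" for k \<omega>
      using return_potential_nonneg[of V \<kappa> "tail_noise k"] V \<kappa> w by (simp add: Z_def)
    have Z_le: "Z k \<omega> \<le> 2" for k \<omega>
      using return_potential_le_2[of V "tail_noise k"] V w by (simp add: Z_def)
    have Z_meas: "Z k \<in> borel_measurable (\<F> k)" for k
      unfolding Z_def[abs_def] using measurable_\<Theta>_\<F>[OF order_refl, of k] by measurable
    have Z_int: "integrable M (Z k)" for k
      using measurable_from_subalg[OF subalgebra_\<F> Z_meas] Z_nonneg Z_le
      by (intro integrable_const_bound[where B=2]) auto
    have D_ev: "D \<in> events" using D subalgebra_\<F>[of n] by (auto simp: subalgebra_def)
    have "c * prob {\<omega>\<in>D. \<exists>k\<ge>n. c \<le> Z k \<omega>} \<le> (\<integral>\<omega>. indicator D \<omega> * Z n \<omega> \<partial>M)"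
    proof (rule prob_le_supermartingale[where F=\<F> and Z=Z and n=n, OF subalgebra_\<F> \<F>_mono Z_meas Z_int Z_nonneg _ c(1) D])
      fix k D assume k: "n \<le> k" and D: "D \<in> sets (\<F> k)"
      define G where "G \<omega> b = return_potential \<kappa> V (tail_noise (Suc k))
        (\<Theta> k \<omega> - 1 / 2 + gain k * (P k \<omega> - \<Theta> k \<omega>) + (real b - real (\<sigma> (Suc k)) * P k \<omega>) / \<tau> (Suc k))" for \<omega> b
      have "(\<integral>\<omega>. indicator D \<omega> * G \<omega> (B (Suc k) \<omega>) \<partial>M) \<le> (\<integral>\<omega>. indicator D \<omega> * Z k \<omega> \<partial>M)"
      proof (rule conditional_expectation_step[OF _ Z_int _ _ D])
        show "(\<lambda>\<omega>. G \<omega> b) \<in> borel_measurable (\<F> k)" for b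
          unfolding G_def[abs_def] using measurable_\<Theta>_\<F>[OF order_refl, of k] measurable_P_\<F>[OF order_refl, of k]
          by measurable
        show "AE \<omega> in M. \<forall>b\<le>\<sigma> (Suc k). \<bar>G \<omega> b\<bar> \<le> 2"
          using return_potential_nonneg[of V \<kappa> "tail_noise (Suc k)"]
            return_potential_le_2[of V "tail_noise (Suc k)" \<kappa>] V \<kappa> w[of "Suc k"] k
          by (intro AE_I2) (simp add: G_def)
        show "AE \<omega> in M. measure_pmf.expectation (binomial_pmf (\<sigma> (Suc k)) (P k \<omega>)) (G \<omega>) \<le> Z k \<omega>"
          using AE_\<Theta>_bounds
        proof eventually_elim
          case (elim \<omega>)
          have "\<bar>P k \<omega> - 1 / 2\<bar> \<le> L * \<bar>\<Theta> k \<omega> - 1 / 2\<bar>" if "(\<Theta> k \<omega> - 1 / 2) ^ 2 \<le> V"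
          proof (rule lip)
            have "\<bar>\<Theta> k \<omega> - 1 / 2\<bar> ^ 2 < \<delta> ^ 2" using that V(2) by simp
            then show "\<bar>\<Theta> k \<omega> - 1 / 2\<bar> < \<delta>" by (rule power_less_imp_less_base[OF _ less_imp_le[OF \<delta>]])
          qed
          from return_potential_supersolution[OF \<alpha> elim[rule_format, of k] L this w(2)[OF k] V(3)]
          show ?case using k unfolding Z_def G_def \<kappa>_def by (simp only: if_True)
        qed
      qed
      also have "(\<lambda>\<omega>. G \<omega> (B (Suc k) \<omega>)) = Z (Suc k)"
        using k by (intro ext) (simp add: G_def Z_def \<Theta>_Suc algebra_simps)
      finally show "(\<integral>\<omega>. indicator D \<omega> * Z (Suc k) \<omega> \<partial>M) \<le> (\<integral>\<omega>. indicator D \<omega> * Z k \<omega> \<partial>M)"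
        by (metis (no_types))
    qed
    also have "\<dots> \<le> (\<integral>\<omega>. indicator D \<omega> * (1 - \<kappa> / 8) \<partial>M)"
      using D_ev integrable_mult_indicator[OF D_ev Z_int[of n]] V \<kappa> return_potential_initial[of V \<kappa>]
      by (intro integral_mono mult_left_mono) (auto simp: Z_def V_def less_top[symmetric])
    also have "\<dots> = (1 - \<kappa> / 8) * prob D" using D_ev by (simp add: sets.Int_space_eq1)
    finally have *: "c * prob {\<omega>\<in>D. \<exists>k\<ge>n. c \<le> Z k \<omega>} \<le> (1 - \<kappa> / 8) * prob D" .
    have "prob (?A \<inter> D) \<le> prob {\<omega>\<in>D. \<exists>k\<ge>n. c \<le> Z k \<omega>}"
    proof (rule finite_measure_mono)
      show "?A \<inter> D \<subseteq> {\<omega>\<in>D. \<exists>k\<ge>n. c \<le> Z k \<omega>}"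
      proof
        fix \<omega> assume "\<omega> \<in> ?A \<inter> D"
        then have lim: "(\<lambda>n. \<Theta> n \<omega>) \<longlonglongrightarrow> 1 / 2" and "\<omega> \<in> D" by auto
        have "(\<lambda>k. return_potential \<kappa> V (tail_noise k) (\<Theta> k \<omega> - 1 / 2)) \<longlonglongrightarrow> 1"
          using tendsto_diff[OF lim tendsto_const[of "1 / 2"]]
          by (intro tendsto_return_potential V tail_noise_tendsto_0) simp
        then have "eventually (\<lambda>k. c < return_potential \<kappa> V (tail_noise k) (\<Theta> k \<omega> - 1 / 2)) sequentially"
          using c by (intro order_tendstoD(1)) auto
        then obtain k where "k \<ge> n" "c < return_potential \<kappa> V (tail_noise k) (\<Theta> k \<omega> - 1 / 2)"
          using eventually_conj[OF eventually_ge_at_top[of n]] by (metis (mono_tags, lifting) eventually_sequentially order_refl)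
        then show "\<omega> \<in> {\<omega>\<in>D. \<exists>k\<ge>n. c \<le> Z k \<omega>}"
          using \<open>\<omega> \<in> D\<close> by (intro CollectI conjI exI[of _ k]) (auto simp: Z_def)
      qed
      have "{\<omega>\<in>D. \<exists>k\<ge>n. c \<le> Z k \<omega>} = D \<inter> (\<Union>k\<in>{n..}. {\<omega>\<in>space M. c \<le> Z k \<omega>})"
        using sets.sets_into_space[OF D_ev] by auto
      also have "\<dots> \<in> events"
        using borel_measurable_le[OF borel_measurable_const measurable_from_subalg[OF subalgebra_\<F> Z_meas]]
        by (intro sets.Int[OF D_ev] sets.countable_UN') auto
      finally show "{\<omega>\<in>D. \<exists>k\<ge>n. c \<le> Z k \<omega>} \<in> events" .
    qed
    then have "c * prob (?A \<inter> D) \<le> (1 - \<kappa> / 8) * prob D"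
      using * c by (meson mult_left_mono order_trans less_imp_le)
    then show "prob (?A \<inter> D) \<le> q * prob D"
      using c by (simp add: q_def field_simps)
  qed
qed

end

theorem theorem1p2:
  fixes M :: "'a measure"
    and \<alpha> :: real
    and \<sigma> :: "nat \<Rightarrow> nat"
    and \<tau>0 T0 :: nat
    and B :: "nat \<Rightarrow> 'a \<Rightarrow> nat"
  assumes model: "balls_and_bins M \<alpha> \<sigma> \<tau>0 T0 B"
    and feedback_exponent: "\<alpha> > 1"
    and S: "bdd_above (\<sigma> ` {1..}) \<or> filterlim \<sigma> at_top sequentially"
    and R: "bounded (range (growth_ratio \<sigma> \<tau>0)) \<or>
            filterlim (growth_ratio \<sigma> \<tau>0) at_top sequentially"
  shows "dominance M \<sigma> \<tau>0 T0 B \<in> sets M \<and> measure M (dominance M \<sigma> \<tau>0 T0 B) = 1"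
proof -
  interpret balls_and_bins M \<alpha> \<sigma> \<tau>0 T0 B by (rule model)
  note [measurable] = measurable_\<Theta>
  let ?D = "dominance M \<sigma> \<tau>0 T0 B"
  have D: "?D \<in> events" unfolding dominance_def by measurable
  have "{\<omega>\<in>space M. (\<lambda>n. \<Theta> n \<omega>) \<longlonglongrightarrow> 1 / 2} \<in> events" by measurable
  then have "AE \<omega> in M. \<omega> \<notin> {\<omega>\<in>space M. (\<lambda>n. \<Theta> n \<omega>) \<longlonglongrightarrow> 1 / 2}"
    using prob_limit_half_zero[OF feedback_exponent] by (subst (asm) prob_eq_0) auto
  then have "AE \<omega> in M. \<omega> \<in> ?D"
    using AE_limit_zero_half_one[OF feedback_exponent] AE_space
    by eventually_elim (auto simp: dominance_def)
  then show ?thesis using D by (simp add: prob_eq_1)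
qed

end
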